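(* Let $\Delta_T>0$ with $\Delta_T\to\Delta_\infty\in(0,\infty)$ as $T\to\infty$. Then for every $\vartheta\in\Theta$ the family of experiments $(\mathcal E^{T,\Delta_T})_{T>0}$ satisfies the LAN property at $\vartheta$ with normalisation $$I_{T,\Delta_\infty}(\vartheta)=T\,\Delta_\infty\,\varphi(\vartheta,\Delta_\infty)=T\Delta_\infty\,\mathbb E_\vartheta\Big[\big(h_{\Delta_\infty}(\vartheta,X_{\Delta_\infty})+(\vartheta\Delta_\infty)^{-1}|X_{\Delta_\infty}|-1\big)^2\Big],$$ and $I_{T,\Delta_T}(\vartheta)\sim I_{T,\Delta_\infty}(\vartheta)$ (ratio tends to $1$) as $T\to\infty$.
   Context: Model: $\Theta\subseteq(0,\infty)$ is an open parameter set. Under $\mathbb P_\vartheta$, $X_t=\sum_{i=1}^{N_t}\varepsilon_i$ ($X_0=0$), where $(N_t)$ is a homogeneous Poisson process of intensity $\vartheta$ and the $\varepsilon_i$ are i.i.d., independent of $(N_t)$, with $\mathbb P(\varepsilon_i=1)=\mathbb P(\varepsilon_i=-1)=1/2$. For $T>0$ and $0<\Delta\le T$, the experiment $\mathcal E^{T,\Delta}=\{\mathbb P^{T,\Delta}_\vartheta,\vartheta\in\Theta\}$ consists of the law $\mathbb P^{T,\Delta}_\vartheta$ of the observation $(X_0,X_\Delta,X_{2\Delta},\dots,X_{\lfloor T/\Delta\rfloor\Delta})$. The increment law is $f_\Delta(\vartheta,k)=\mathbb P_\vartheta(X_\Delta=k)=e^{-\vartheta\Delta}\mathcal I_{|k|}(\vartheta\Delta)$,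 $k\in\mathbb Z$, where $\mathcal I_\nu(x)=\sum_{m\ge0}\frac{(x/2)^{2m+\nu}}{m!\,\Gamma(\nu+m+1)}$ is the modified Bessel function of the first kind. Set $h_\Delta(\vartheta,k)=\mathcal I_{|k|+1}(\vartheta\Delta)/\mathcal I_{|k|}(\vartheta\Delta)$ and $\varphi(\vartheta,\Delta)=\mathbb E_\vartheta\big[\big(h_\Delta(\vartheta,X_\Delta)+(\vartheta\Delta)^{-1}|X_\Delta|-1\big)^2\big]$. LAN: the family $(\mathcal E^{T,\Delta_T})_{T>0}$ satisfies the LAN property at $\vartheta$ with normalisation $I_T(\vartheta)>0$ if for every $v\in\mathbb R$ with $\vartheta+vI_T(\vartheta)^{-1/2}\in\Theta$, $\frac{d\mathbb P^{T,\Delta_T}_{\vartheta+vI_T(\vartheta)^{-1/2}}}{d\mathbb P^{T,\Delta_T}_\vartheta}=\exp(v\xi_T-\tfrac12v^2+r_T)$, where $\xi_T\to\mathcal N(0,1)$ in distribution and $r_T\to0$ in probability under $\mathbb P^{T,\Delta_T}_\vartheta$ as $T\to\infty$. *)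

theory Defs
  imports "HOL-Probability.Probability"
begin

definition bessel_I :: "nat \<Rightarrow> real \<Rightarrow> real" where
  "bessel_I nu x = (\<Sum>m. (x / 2) ^ (2 * m + nu) / (fact m * Gamma (real nu + real m + 1)))"

definition rademacher_pmf :: "int pmf" where
  "rademacher_pmf = pmf_of_set {-1, 1}"

fun iid_pmf :: "nat \<Rightarrow> 'a pmf \<Rightarrow> 'a list pmf" where
  "iid_pmf 0 p = return_pmf []"
| "iid_pmf (Suc n) p = bind_pmf p (\<lambda>x. bind_pmf (iid_pmf n p) (\<lambda>xs. return_pmf (x # xs)))"

definition incr_pmf :: "real \<Rightarrow> real \<Rightarrow> int pmf" where
  "incr_pmf \<theta> \<Delta> =
     bind_pmf (poisson_pmf (\<theta> * \<Delta>)) (\<lambda>N. map_pmf sum_list (iid_pmf N rademacher_pmf))"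

definition psums :: "int list \<Rightarrow> int list" where
  "psums xs = map (\<lambda>j. sum_list (take j xs)) [0..<Suc (length xs)]"

text \<open>Law P^{T,Delta}_theta of the observation (X_0, X_Delta, ..., X_{floor(T/Delta) Delta}):
  the increments over the grid intervals are i.i.d. with the law of X_Delta.\<close>
definition obs_pmf :: "real \<Rightarrow> real \<Rightarrow> real \<Rightarrow> int list pmf" where
  "obs_pmf T \<Delta> \<theta> = map_pmf psums (iid_pmf (nat \<lfloor>T / \<Delta>\<rfloor>) (incr_pmf \<theta> \<Delta>))"

definition h_fun :: "real \<Rightarrow> real \<Rightarrow> int \<Rightarrow> real" where
  "h_fun \<Delta> \<theta> k = bessel_I (nat \<bar>k\<bar> + 1) (\<theta> * \<Delta>) / bessel_I (nat \<bar>k\<bar>) (\<theta> * \<Delta>)"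

definition phi :: "real \<Rightarrow> real \<Rightarrow> real" where
  "phi \<theta> \<Delta> = measure_pmf.expectation (incr_pmf \<theta> \<Delta>)
      (\<lambda>k. (h_fun \<Delta> \<theta> k + \<bar>real_of_int k\<bar> / (\<theta> * \<Delta>) - 1)\<^sup>2)"

definition conv_distr_std_normal :: "(real \<Rightarrow> 'a pmf) \<Rightarrow> (real \<Rightarrow> 'a \<Rightarrow> real) \<Rightarrow> bool" where
  "conv_distr_std_normal P \<xi> \<longleftrightarrow>
     (\<forall>g :: real \<Rightarrow> real. continuous_on UNIV g \<and> bounded (range g) \<longrightarrow>
        ((\<lambda>T. measure_pmf.expectation (P T) (\<lambda>\<omega>. g (\<xi> T \<omega>)))
           \<longlongrightarrow> integral\<^sup>L std_normal_distribution g) at_top)"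

definition conv_prob_zero :: "(real \<Rightarrow> 'a pmf) \<Rightarrow> (real \<Rightarrow> 'a \<Rightarrow> real) \<Rightarrow> bool" where
  "conv_prob_zero P r \<longleftrightarrow>
     (\<forall>\<epsilon>>0. ((\<lambda>T. measure_pmf.prob (P T) {\<omega>. \<bar>r T \<omega>\<bar> > \<epsilon>}) \<longlongrightarrow> 0) at_top)"

text \<open>LAN property at theta of the family (P T ._)_{T>0} over parameter set Theta with
  normalisation I. The likelihood ratio dP'/dP is taken P-a.s., i.e. on the support of P.\<close>
definition LAN :: "(real \<Rightarrow> real \<Rightarrow> 'a pmf) \<Rightarrow> real set \<Rightarrow> real \<Rightarrow> (real \<Rightarrow> real) \<Rightarrow> bool" where
  "LAN P \<Theta> \<theta> I \<longleftrightarrow>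
     (\<forall>T>0. I T > 0) \<and>
     (\<exists>\<xi>. conv_distr_std_normal (\<lambda>T. P T \<theta>) \<xi> \<and>
        (\<forall>v. \<exists>r.
           (\<forall>T>0. \<theta> + v / sqrt (I T) \<in> \<Theta> \<longrightarrow>
              (\<forall>\<omega>\<in>set_pmf (P T \<theta>).
                 pmf (P T (\<theta> + v / sqrt (I T))) \<omega> / pmf (P T \<theta>) \<omega>
                   = exp (v * \<xi> T \<omega> - v\<^sup>2 / 2 + r T \<omega>))) \<and>
           conv_prob_zero (\<lambda>T. P T \<theta>) r))"

end

theory Submission
  imports Defs
begin

text \<open>
  The increments over the grid are i.i.d. with a symmetric Skellam law whose parameter
  \<open>x = \<theta> \<Delta>\<close> converges to an interior point, so the theorem is local asymptotic normality
  for a smooth one-parameter triangular array.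
  The score is \<open>s = h + |k|/x - 1\<close> with \<open>h\<close> the Bessel quotient. The recurrence \<open>I' = I\<^sub>n\<^sub>+\<^sub>1 + (n/x) I\<^sub>n\<close>
  gives \<open>h' = h (h\<^sub>n\<^sub>+\<^sub>1 - h + 1/x)\<close> and \<open>0 \<le> h \<le> x\<close>, so \<open>s\<close> and \<open>s'\<close> grow at most linearly in
  \<open>|k|\<close>, locally uniformly in \<open>x\<close>. Together with the factorial decay of the Skellam weights this
  lets every limit of expectations be taken by dominated convergence. The identities \<open>E s = 0\<close> and
  \<open>E s' = - E s\<^sup>2\<close> come from shift invariance of the counting measure, because
  \<open>p(k - 1) + p(k + 1) = 2 (s(k) + 1) p(k)\<close>.
  The normalised score sum is treated with characteristic functions and Levy's theorem; the
  remainder of the log-likelihood ratio is an i.i.d. sum of second-order Taylor remainders, to which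
  Chebyshev's inequality applies.
\<close>

section \<open>Modified Bessel functions\<close>

text \<open>This is the entire function ${}_0F_1(;n+1;y)/n!$. Since \<open>bessel_I n x\<close> is
  \<open>(x/2)^n\<close> times its value at \<open>x^2/4\<close>, positivity, bounds, derivative and
  recurrence of the Bessel functions all reduce to a power series with positive
  coefficients.\<close>

definition bessel_series :: "nat \<Rightarrow> real \<Rightarrow> real" where
  "bessel_series n y = (\<Sum>m. y ^ m / (fact m * fact (m + n)))"

lemma summable_bessel_series: "summable (\<lambda>m. y ^ m / (fact m * fact (m + n)) :: real)"
proof (rule summable_comparison_test)
  show "\<exists>N. \<forall>m\<ge>N. norm (y ^ m / (fact m * fact (m + n))) \<le> norm (y ^ m) / fact m"
  proof (intro exI[of _ 0] allI impI)
    fix m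
    have "(fact m :: real) \<le> fact m * fact (m + n)"
      by (simp add: mult_le_cancel_left1)
    then show "norm (y ^ m / (fact m * fact (m + n))) \<le> norm (y ^ m) / fact m"
      by (simp add: abs_mult frac_le)
  qed
  show "summable (\<lambda>m. norm (y ^ m) / fact m)"
    using summable_exp[of "\<bar>y\<bar>"] by (simp add: power_abs divide_inverse mult.commute)
qed

lemma bessel_I_eq_series: "bessel_I n x = (x / 2) ^ n * bessel_series n (x\<^sup>2 / 4)"
proof -
  have "(x / 2) ^ (2 * m + n) / (fact m * Gamma (real n + real m + 1)) =
        (x / 2) ^ n * ((x\<^sup>2 / 4) ^ m / (fact m * fact (m + n)))" for m
  proof -
    have "Gamma (real n + real m + 1) = fact (m + n)"
      using Gamma_fact[of "m + n", where 'a = real] by (simp add: add_ac)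
    moreover have "(x / 2) ^ (2 * m + n) = (x / 2) ^ n * ((x / 2)\<^sup>2) ^ m"
      by (simp add: power_add power_mult)
    then have "(x / 2) ^ (2 * m + n) = (x / 2) ^ n * (x\<^sup>2 / 4) ^ m"
      by (simp add: power2_eq_square)
    ultimately show ?thesis by simp
  qed
  then show ?thesis
    unfolding bessel_I_def bessel_series_def
    by (simp only: suminf_mult[OF summable_bessel_series])
qed

lemma bessel_series_pos: "y \<ge> 0 \<Longrightarrow> bessel_series n y > 0"
  unfolding bessel_series_def
  by (rule suminf_pos2[OF summable_bessel_series, of _ _ 0]) auto

text \<open>Replacing \<open>(m + n)!\<close> by the smaller \<open>n!\<close> leaves the
  exponential series. The surviving \<open>1 / n!\<close> is what later dominates the Skellam
  weights at large \<open>|k|\<close>.\<close>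

lemma bessel_series_le:
  assumes "y \<ge> 0" shows "bessel_series n y \<le> exp y / fact n"
proof -
  have "y ^ m / (fact m * fact (m + n)) \<le> inverse (fact n) * (inverse (fact m) * y ^ m)" for m
  proof -
    have "(fact n :: real) \<le> fact (m + n)" by (rule fact_mono) simp
    then show ?thesis using mult_left_mono[of "fact n" "fact (m + n) :: real" "y ^ m"] assms
      by (simp add: field_simps)
  qed
  then have "bessel_series n y \<le> (\<Sum>m. inverse (fact n) * (inverse (fact m) * y ^ m))"
    unfolding bessel_series_def
    by (intro suminf_le summable_bessel_series summable_mult summable_exp) auto
  also have "\<dots> = exp y / fact n"
    by (subst suminf_mult[OF summable_exp]) (simp add: exp_def divide_inverse mult.commute)
  finally show ?thesis .
qed

text \<open>Differentiation brings down a factor that cancels against one factorial, so the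
  coefficients of index n become those of index n + 1.\<close>

lemma bessel_series_deriv: "(bessel_series n has_real_derivative bessel_series (Suc n) y) (at y)"
proof -
  define c :: "nat \<Rightarrow> real" where "c m = 1 / (fact m * fact (m + n))" for m
  have 1: "bessel_series n = (\<lambda>y. \<Sum>m. c m * y ^ m)"
    by (simp add: bessel_series_def c_def fun_eq_iff)
  have "diffs c m * y ^ m = y ^ m / (fact m * fact (m + Suc n))" for m
    by (simp add: diffs_def c_def field_simps del: of_nat_Suc)
  then have 2: "bessel_series (Suc n) y = (\<Sum>m. diffs c m * y ^ m)"
    by (simp add: bessel_series_def)
  show ?thesis
    unfolding 1 2
    by (rule termdiffs_strong_converges_everywhere)
       (use summable_bessel_series[of _ n] in \<open>simp add: c_def\<close>)
qed

text \<open>Termwise, \<open>(n + 1) + m\<close> divided by \<open>(m + n + 1)!\<close> is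
  \<open>1 / (m + n)!\<close>. The part carrying m is y times the series of index n + 2.\<close>

lemma bessel_series_rec:
  "bessel_series n y = real (Suc n) * bessel_series (Suc n) y + y * bessel_series (Suc (Suc n)) y"
proof -
  have "(\<lambda>m. real (Suc n) * (y ^ m / (fact m * fact (m + Suc n)))) sums (real (Suc n) * bessel_series (Suc n) y)"
    unfolding bessel_series_def
    by (intro sums_mult summable_sums summable_bessel_series)
  moreover
  have "(\<lambda>m. y * (y ^ m / (fact m * fact (m + Suc (Suc n))))) sums (y * bessel_series (Suc (Suc n)) y)"
    unfolding bessel_series_def
    by (intro sums_mult summable_sums summable_bessel_series)
  \<comment> \<open>Multiplication by y raises the summation index by one; the new term at
    \<open>m = 0\<close> vanishes because of the factor m.\<close>
  then have "(\<lambda>m. real m * (y ^ m / (fact m * fact (m + Suc n)))) sums (y * bessel_series (Suc (Suc n)) y)"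
    using sums_Suc_iff[of "\<lambda>m. real m * (y ^ m / (fact m * fact (m + Suc n)))"]
    by (simp add: field_simps del: of_nat_Suc)
  ultimately have "(\<lambda>m. real (Suc n) * (y ^ m / (fact m * fact (m + Suc n))) + real m * (y ^ m / (fact m * fact (m + Suc n))))
    sums (real (Suc n) * bessel_series (Suc n) y + y * bessel_series (Suc (Suc n)) y)"
    by - (rule sums_add)
  moreover have "real (Suc n) * (y ^ m / (fact m * fact (m + Suc n))) + real m * (y ^ m / (fact m * fact (m + Suc n)))
     = y ^ m / (fact m * fact (m + n))" for m
  proof -
    have "(fact (m + Suc n) :: real) = real (m + Suc n) * fact (m + n)"
      by (simp del: of_nat_Suc of_nat_add)
    then have "real (m + Suc n) * (y ^ m / (fact m * fact (m + Suc n))) = y ^ m / (fact m * fact (m + n))"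
      by (simp del: of_nat_Suc of_nat_add fact_Suc add_Suc_right)
    then show ?thesis by (simp only: distrib_right[symmetric] of_nat_add[symmetric] add.commute)
  qed
  ultimately show ?thesis
    unfolding bessel_series_def[of n] by (simp add: sums_iff)
qed

lemma bessel_I_pos: "x > 0 \<Longrightarrow> bessel_I n x > 0"
  by (simp add: bessel_I_eq_series bessel_series_pos)

lemma bessel_I_le:
  assumes "x \<ge> 0" shows "bessel_I n x \<le> exp (x\<^sup>2 / 4) * (x / 2) ^ n / fact n"
  using mult_left_mono[OF bessel_series_le[of "x\<^sup>2/4" n], of "(x/2)^n"] assms
  by (simp add: bessel_I_eq_series mult_ac)

lemma bessel_I_rec:
  assumes "x > 0"
  shows "bessel_I n x = 2 * real (Suc n) / x * bessel_I (Suc n) x + bessel_I (Suc (Suc n)) x"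
  using assms
  by (subst (1 2 3) bessel_I_eq_series, subst bessel_series_rec)
     (simp add: field_simps power2_eq_square del: of_nat_Suc)

text \<open>The product rule on \<open>(x/2)^n * bessel_series n (x^2/4)\<close>. In this form the
  logarithmic derivative is \<open>I_(n+1)/I_n + n/x\<close>, which becomes the score up to the
  constant -1.\<close>

lemma bessel_I_deriv:
  assumes "x > 0"
  shows "(bessel_I n has_real_derivative (bessel_I (Suc n) x + real n / x * bessel_I n x)) (at x)"
proof -
  have "((\<lambda>x. (x / 2) ^ n * bessel_series n (x\<^sup>2 / 4)) has_real_derivative
     (real n * (x / 2) ^ (n - 1) * (1 / 2)) * bessel_series n (x\<^sup>2 / 4) +
      (bessel_series (Suc n) (x\<^sup>2 / 4) * (2 * x / 4)) * (x / 2) ^ n) (at x)"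
    by (rule derivative_eq_intros DERIV_chain2[OF bessel_series_deriv] refl | simp)+
  also have "(\<lambda>x. (x / 2) ^ n * bessel_series n (x\<^sup>2 / 4)) = bessel_I n"
    by (simp add: bessel_I_eq_series fun_eq_iff)
  also have "(real n * (x / 2) ^ (n - 1) * (1 / 2)) * bessel_series n (x\<^sup>2 / 4) +
      (bessel_series (Suc n) (x\<^sup>2 / 4) * (2 * x / 4)) * (x / 2) ^ n
      = bessel_I (Suc n) x + real n / x * bessel_I n x"
    \<comment> \<open>The case split removes the truncated exponent \<open>n - 1\<close> at
      \<open>n = 0\<close>.\<close>
    using assms by (cases n) (simp_all add: bessel_I_eq_series field_simps)
  finally show ?thesis .
qed

section \<open>Quotients of consecutive Bessel functions\<close>

definition bessel_ratio :: "nat \<Rightarrow> real \<Rightarrow> real" where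
  "bessel_ratio n x = bessel_I (Suc n) x / bessel_I n x"

lemma bessel_ratio_nonneg: "x > 0 \<Longrightarrow> bessel_ratio n x \<ge> 0"
  by (simp add: bessel_ratio_def bessel_I_pos less_imp_le)

text \<open>Both summands of the recurrence are positive, so \<open>2(n+1)/x * I_(n+1)\<close> is at
  most \<open>I_n\<close>; the cruder bound x no longer depends on n.\<close>

lemma bessel_ratio_le:
  assumes "x > 0" shows "bessel_ratio n x \<le> x"
proof -
  have "bessel_I (Suc n) x \<le> x * (2 * real (Suc n) / x * bessel_I (Suc n) x)"
    using assms bessel_I_pos[OF assms, of "Suc n"]
    by simp
  also have "\<dots> \<le> x * bessel_I n x"
    using assms bessel_I_pos[OF assms, of "Suc (Suc n)"]
    by (subst (2) bessel_I_rec[OF assms]) (intro mult_left_mono, auto)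
  finally show ?thesis
    using bessel_I_pos[OF assms, of n] by (simp add: bessel_ratio_def field_simps)
qed

text \<open>The quotient rule, where the terms \<open>(n+1)/x\<close> and \<open>n/x\<close> leave
  the difference \<open>1/x\<close>.\<close>

lemma bessel_ratio_deriv:
  assumes "x > 0"
  shows "(bessel_ratio n has_real_derivative
     bessel_ratio n x * (bessel_ratio (Suc n) x - bessel_ratio n x + 1 / x)) (at x)"
proof -
  have pos: "bessel_I k x \<noteq> 0" for k using bessel_I_pos[OF assms, of k] by simp
  have "((\<lambda>x. bessel_I (Suc n) x / bessel_I n x) has_real_derivative
    ((bessel_I (Suc (Suc n)) x + real (Suc n) / x * bessel_I (Suc n) x) * bessel_I n x
      - bessel_I (Suc n) x * (bessel_I (Suc n) x + real n / x * bessel_I n x)) / (bessel_I n x * bessel_I n x)) (at x)"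
    by (intro DERIV_divide bessel_I_deriv assms pos)
  moreover have "((bessel_I (Suc (Suc n)) x + real (Suc n) / x * bessel_I (Suc n) x) * bessel_I n x
      - bessel_I (Suc n) x * (bessel_I (Suc n) x + real n / x * bessel_I n x)) / (bessel_I n x * bessel_I n x)
    = bessel_ratio n x * (bessel_ratio (Suc n) x - bessel_ratio n x + 1 / x)"
    using assms pos[of n] pos[of "Suc n"] by (simp add: bessel_ratio_def field_simps)
  ultimately show ?thesis by (simp add: bessel_ratio_def[abs_def])
qed

section \<open>The symmetric Skellam distribution\<close>

lemma pmf_walk_Suc:
  "pmf (map_pmf sum_list (iid_pmf (Suc n) rademacher_pmf)) k =
    (pmf (map_pmf sum_list (iid_pmf n rademacher_pmf)) (k - 1) +
     pmf (map_pmf sum_list (iid_pmf n rademacher_pmf)) (k + 1)) / 2"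
proof -
  let ?W = "map_pmf sum_list (iid_pmf n rademacher_pmf)"
  have "map_pmf sum_list (iid_pmf (Suc n) rademacher_pmf) =
    bind_pmf rademacher_pmf (\<lambda>x. map_pmf ((+) x) ?W)"
    by (simp add: map_bind_pmf map_pmf_comp) (simp add: map_pmf_def bind_assoc_pmf bind_return_pmf)
  moreover have "pmf (map_pmf ((+) x) ?W) k = pmf ?W (k - x)" for x
    using pmf_map_inj'[of "(+) x" ?W "k - x"] by simp
  ultimately show ?thesis
    by (simp add: pmf_bind rademacher_pmf_def integral_pmf_of_set)
qed

text \<open>Here j counts the steps +1 among n steps. The induction conditions on the first step and
  uses Pascal's rule; j may exceed n, where the binomial coefficient is zero.\<close>

lemma pmf_walk:
  "pmf (map_pmf sum_list (iid_pmf n rademacher_pmf)) (2 * int j - int n) = real (n choose j) / 2 ^ n"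
  "(\<And>j. k \<noteq> 2 * int j - int n) \<Longrightarrow> pmf (map_pmf sum_list (iid_pmf n rademacher_pmf)) k = 0"
proof (induction n arbitrary: j k)
  case 0
  { case 1 show ?case by (cases j) (auto simp: indicator_def) }
  { case 2 then show ?case using "2"[of 0] by (auto simp: indicator_def) }
next
  case (Suc n)
  { case 1
    have r: "2 * int j - int (Suc n) + 1 = 2 * int j - int n" by simp
    show ?case
    proof (cases j)
      case 0
      \<comment> \<open>With no step +1 at all, this neighbour is \<open>-n - 2\<close> and lies
        below the range of an n-step walk.\<close>
      have "pmf (map_pmf sum_list (iid_pmf n rademacher_pmf)) (2 * int j - int (Suc n) - 1) = 0"
        using 0 by (intro Suc.IH(2)) simp
      then show ?thesis
        unfolding pmf_walk_Suc r using Suc.IH(1)[of j] 0 by simp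
    next
      case (Suc i)
      have l: "2 * int j - int (Suc n) - 1 = 2 * int i - int n" using Suc by simp
      show ?thesis
        unfolding pmf_walk_Suc r l Suc.IH(1) using Suc by (simp add: field_simps)
    qed }
  { case 2
    have "k - 1 \<noteq> 2 * int j - int n" for j
      using 2[of "Suc j"] by auto
    moreover have "k + 1 \<noteq> 2 * int j - int n" for j
      using 2[of j] by auto
    ultimately show ?case
      unfolding pmf_walk_Suc using Suc.IH(2) by simp }
qed

text \<open>Conditioning on the number N of jumps gives a series in N. Only
  \<open>N = 2m + |k|\<close> can reach k, with m cancelling pairs of jumps, and summing over m
  yields the Bessel series.\<close>

lemma pmf_incr_pmf:
  assumes "\<theta> * \<Delta> > 0"
  shows "pmf (incr_pmf \<theta> \<Delta>) k = exp (- (\<theta> * \<Delta>)) * bessel_I (nat \<bar>k\<bar>) (\<theta> * \<Delta>)"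
proof -
  define x where "x = \<theta> * \<Delta>"
  define n where "n = nat \<bar>k\<bar>"
  define w where "w N = pmf (map_pmf sum_list (iid_pmf N rademacher_pmf)) k" for N
  have x: "x > 0" using assms by (simp add: x_def)
  define g :: "nat \<Rightarrow> real" where "g N = pmf (poisson_pmf x) N * w N" for N
  have w01: "0 \<le> w N" "w N \<le> 1" for N by (simp_all add: w_def pmf_le_1)
  have int: "integrable (count_space UNIV) g"
    by (rule Bochner_Integration.integrable_bound[OF integrable_pmf[of UNIV "poisson_pmf x"]])
       (use w01 in \<open>auto simp: g_def mult_left_le\<close>)
  have "pmf (incr_pmf \<theta> \<Delta>) k = (\<integral>N. w N \<partial>measure_pmf (poisson_pmf x))"
    by (simp add: incr_pmf_def pmf_bind w_def x_def)
  also have "\<dots> = integral\<^sup>L (count_space UNIV) g"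
    unfolding g_def by (simp add: measure_pmf_eq_density integral_density)
  finally have 1: "g sums pmf (incr_pmf \<theta> \<Delta>) k"
    using sums_integral_count_space_nat[OF int] by simp
  have supp: "w N = 0" if N: "N \<notin> range (\<lambda>m. 2 * m + n)" for N
  proof (cases "\<exists>j. k = 2 * int j - int N")
    case False
    then show ?thesis unfolding w_def by (intro pmf_walk(2)) auto
  next
    case True
    then obtain j where k: "k = 2 * int j - int N" by blast
    \<comment> \<open>With at most N up-steps, N would be \<open>|k|\<close> plus twice the smaller
      of the numbers of up-steps and down-steps, hence in the excluded range.\<close>
    have "j > N"
    proof (rule ccontr)
      assume "\<not> j > N"
      then have "N = 2 * (if k \<ge> 0 then N - j else j) + n"
        unfolding n_def k by auto
      then show False using N by blast
    qed
    then show ?thesis unfolding w_def k pmf_walk(1) by (simp add: binomial_eq_0)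
  qed
  \<comment> \<open>The number of up-steps is \<open>m + n\<close> for \<open>k >= 0\<close> and m
    otherwise; by symmetry both binomial coefficients have the same factorial form.\<close>
  have val: "w (2 * m + n) = real (fact (2 * m + n)) / (fact m * fact (m + n)) / 2 ^ (2 * m + n)" for m
  proof (cases "k \<ge> 0")
    case True
    then have "k = 2 * int (m + n) - int (2 * m + n)" by (simp add: n_def)
    then show ?thesis
      unfolding w_def using pmf_walk(1)[of "2 * m + n" "m + n"] by (simp add: binomial_fact mult_ac add_ac)
  next
    case False
    then have "k = 2 * int m - int (2 * m + n)" by (simp add: n_def)
    then show ?thesis
      unfolding w_def using pmf_walk(1)[of "2 * m + n" "m"] by (simp add: binomial_fact mult_ac add_ac)
  qed
  have "(\<lambda>m. g (2 * m + n)) sums pmf (incr_pmf \<theta> \<Delta>) k"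
    by (subst sums_mono_reindex) (use 1 supp in \<open>auto simp: strict_mono_def g_def\<close>)
  moreover have "g (2 * m + n) = exp (- x) * (x / 2) ^ n * ((x\<^sup>2 / 4) ^ m / (fact m * fact (m + n)))" for m
  proof -
    have "(x / 2) ^ (2 * m + n) = (x / 2) ^ n * ((x / 2)\<^sup>2) ^ m"
      by (simp add: power_add power_mult)
    then have "x ^ (2 * m + n) / 2 ^ (2 * m + n) = (x / 2) ^ n * (x\<^sup>2 / 4) ^ m"
      by (simp add: power2_eq_square flip: power_divide)
    moreover have "g (2 * m + n) = exp (- x) * (x ^ (2 * m + n) / 2 ^ (2 * m + n)) / (fact m * fact (m + n))"
      unfolding g_def val using x by (simp add: field_simps)
    ultimately show ?thesis by simp
  qed
  ultimately have "(\<lambda>m. exp (- x) * (x / 2) ^ n * ((x\<^sup>2 / 4) ^ m / (fact m * fact (m + n)))) sums pmf (incr_pmf \<theta> \<Delta>) k"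
    by simp
  moreover have "(\<lambda>m. exp (- x) * (x / 2) ^ n * ((x\<^sup>2 / 4) ^ m / (fact m * fact (m + n))))
      sums (exp (- x) * (x / 2) ^ n * bessel_series n (x\<^sup>2 / 4))"
    unfolding bessel_series_def by (intro sums_mult summable_sums summable_bessel_series)
  ultimately have "pmf (incr_pmf \<theta> \<Delta>) k = exp (- x) * (x / 2) ^ n * bessel_series n (x\<^sup>2 / 4)"
    by (rule sums_unique2)
  then show ?thesis by (simp add: bessel_I_eq_series x_def n_def)
qed

text \<open>The increment law depends on \<theta> and \<Delta> only through
  \<open>x = \<theta> * \<Delta>\<close>; it is the law of the difference of two independent Poisson
  variables of mean \<open>x/2\<close>.\<close>

definition skellam_pmf :: "real \<Rightarrow> int pmf" where
  "skellam_pmf x = incr_pmf x 1"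

lemma incr_pmf_eq_skellam: "incr_pmf \<theta> \<Delta> = skellam_pmf (\<theta> * \<Delta>)"
  by (simp add: skellam_pmf_def incr_pmf_def)

lemma pmf_skellam: "x > 0 \<Longrightarrow> pmf (skellam_pmf x) k = exp (- x) * bessel_I (nat \<bar>k\<bar>) x"
  by (simp add: skellam_pmf_def pmf_incr_pmf)

lemma pmf_skellam_pos: "x > 0 \<Longrightarrow> pmf (skellam_pmf x) k > 0"
  by (simp add: pmf_skellam bessel_I_pos)

lemma set_pmf_skellam: "x > 0 \<Longrightarrow> set_pmf (skellam_pmf x) = UNIV"
  using pmf_skellam_pos[of x] by (auto simp: set_pmf_eq less_imp_neq[symmetric])

section \<open>The score, its derivative and their growth\<close>

definition skellam_score :: "real \<Rightarrow> int \<Rightarrow> real" where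
  "skellam_score x k = bessel_ratio (nat \<bar>k\<bar>) x + \<bar>real_of_int k\<bar> / x - 1"

definition skellam_score_deriv :: "real \<Rightarrow> int \<Rightarrow> real" where
  "skellam_score_deriv x k = (let n = nat \<bar>k\<bar> in
     bessel_ratio n x * (bessel_ratio (Suc n) x - bessel_ratio n x + 1 / x) - \<bar>real_of_int k\<bar> / x\<^sup>2)"

lemma skellam_score_has_deriv:
  assumes "x > 0"
  shows "((\<lambda>x. skellam_score x k) has_real_derivative skellam_score_deriv x k) (at x)"
  unfolding skellam_score_def skellam_score_deriv_def Let_def
  by (rule derivative_eq_intros bessel_ratio_deriv refl assms | use assms in \<open>simp add: power2_eq_square\<close>)+

text \<open>The closed form of the weights is available for positive parameters only, so derivatives
  are transferred through equality near x.\<close>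

lemma eventually_pmf_skellam:
  assumes "x > 0"
  shows "\<forall>\<^sub>F y in nhds x. exp (- y) * bessel_I (nat \<bar>k\<bar>) y = pmf (skellam_pmf y) k"
proof -
  have "\<forall>\<^sub>F y in nhds x. y \<in> {0<..}"
    using assms by (intro eventually_nhds_in_open) auto
  then show ?thesis by eventually_elim (simp add: pmf_skellam)
qed

text \<open>Identifies \<open>skellam_score\<close> as the derivative of the log-likelihood in x:
  the -1 comes from \<open>exp (- x)\<close>, the rest from \<open>bessel_I_deriv\<close>.\<close>

lemma pmf_skellam_has_deriv:
  assumes "x > 0"
  shows "((\<lambda>x. pmf (skellam_pmf x) k) has_real_derivative skellam_score x k * pmf (skellam_pmf x) k) (at x)"
proof -
  have "((\<lambda>x. exp (- x) * bessel_I (nat \<bar>k\<bar>) x) has_real_derivative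
     skellam_score x k * pmf (skellam_pmf x) k) (at x)"
    by (rule derivative_eq_intros bessel_I_deriv refl assms)+
       (use bessel_I_pos[OF assms, of "nat \<bar>k\<bar>"] assms in
         \<open>simp add: skellam_score_def pmf_skellam bessel_ratio_def field_simps\<close>)
  then show ?thesis
    using DERIV_cong_ev[OF refl eventually_pmf_skellam[OF assms] refl] by simp
qed

text \<open>As \<open>s p\<close> is the derivative of p, this is the Kolmogorov forward equation
  \<open>p' = (p(k-1) + p(k+1))/2 - p(k)\<close> of the walk. For \<open>|k| = n + 1\<close> the
  neighbours have moduli n and n + 2, and the recurrence eliminates \<open>I_n\<close>; at 0 both
  neighbours have modulus 1.\<close>

lemma pmf_skellam_neighbours:
  assumes "x > 0"
  shows "pmf (skellam_pmf x) (k - 1) + pmf (skellam_pmf x) (k + 1) =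
     2 * (skellam_score x k + 1) * pmf (skellam_pmf x) k"
proof (cases "k = 0")
  case True
  then show ?thesis
    using assms bessel_I_pos[OF assms, of 0] by (simp add: pmf_skellam skellam_score_def bessel_ratio_def)
next
  case False
  define n where "n = nat \<bar>k\<bar> - 1"
  have n: "nat \<bar>k\<bar> = Suc n" "\<bar>real_of_int k\<bar> = real (Suc n)"
    "pmf (skellam_pmf x) (k - 1) + pmf (skellam_pmf x) (k + 1) = exp (- x) * bessel_I n x + exp (- x) * bessel_I (Suc (Suc n)) x"
  proof -
    show 1: "nat \<bar>k\<bar> = Suc n" using False by (auto simp: n_def)
    then show "\<bar>real_of_int k\<bar> = real (Suc n)" by linarith
    show "pmf (skellam_pmf x) (k - 1) + pmf (skellam_pmf x) (k + 1) = exp (- x) * bessel_I n x + exp (- x) * bessel_I (Suc (Suc n)) x"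
    proof (cases "k > 0")
      case True
      then have "nat \<bar>k - 1\<bar> = n" "nat \<bar>k + 1\<bar> = Suc (Suc n)" using 1 by linarith+
      then show ?thesis by (simp only: pmf_skellam[OF assms])
    next
      case False
      then have "nat \<bar>k - 1\<bar> = Suc (Suc n)" "nat \<bar>k + 1\<bar> = n" using 1 by linarith+
      then show ?thesis by (simp only: pmf_skellam[OF assms] add.commute)
    qed
  qed
  \<comment> \<open>Used with \<open>b = I_(n+1)\<close>, \<open>c = I_(n+2)\<close>,
    \<open>d = n + 1\<close> and \<open>e = exp (- x)\<close>.\<close>
  have "2 * (c / b + d / x - 1 + 1) * (e * b) = e * (2 * d / x * b + c) + e * c"
    if "b > 0" for b c d e :: real
    using that assms by (simp add: field_simps)
  from this[OF bessel_I_pos[OF assms, of "Suc n"]]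
  show ?thesis
    unfolding n(3) unfolding skellam_score_def n(1,2) pmf_skellam[OF assms] bessel_ratio_def
    by (subst bessel_I_rec[OF assms, of n]) metis
qed

text \<open>Solve the neighbour identity for the score, differentiate the resulting quotient using
  \<open>p' = s p\<close>, and compare with the known derivative by uniqueness. No further Bessel
  identities are involved.\<close>

lemma skellam_score_deriv_neighbours:
  assumes "x > 0"
  shows "2 * skellam_score_deriv x k * pmf (skellam_pmf x) k =
    pmf (skellam_pmf x) (k - 1) * (skellam_score x (k - 1) - skellam_score x k) +
    pmf (skellam_pmf x) (k + 1) * (skellam_score x (k + 1) - skellam_score x k)"
proof -
  let ?P = "\<lambda>k. pmf (skellam_pmf x) k" and ?s = "skellam_score x"
  have ne: "?P k \<noteq> 0" using pmf_skellam_pos[OF assms, of k] by simp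
  have "((\<lambda>x. (pmf (skellam_pmf x) (k - 1) + pmf (skellam_pmf x) (k + 1)) / (2 * pmf (skellam_pmf x) k) - 1)
     has_real_derivative ((?s (k - 1) * ?P (k - 1) + ?s (k + 1) * ?P (k + 1)) * (2 * ?P k)
       - (?P (k - 1) + ?P (k + 1)) * (2 * (?s k * ?P k))) / (2 * ?P k)\<^sup>2) (at x)"
    by (rule derivative_eq_intros pmf_skellam_has_deriv refl assms | use ne in \<open>simp add: power2_eq_square\<close>)+
  moreover have "\<forall>\<^sub>F y in nhds x. (pmf (skellam_pmf y) (k - 1) + pmf (skellam_pmf y) (k + 1)) / (2 * pmf (skellam_pmf y) k) - 1 = skellam_score y k"
  proof -
    have "\<forall>\<^sub>F y in nhds x. y \<in> {0<..}"
      using assms by (intro eventually_nhds_in_open) auto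
    then show ?thesis
    proof eventually_elim
      case (elim y)
      then show ?case
        using pmf_skellam_neighbours[of y k] pmf_skellam_pos[of y k] by (simp add: field_simps)
    qed
  qed
  ultimately have "((\<lambda>x. skellam_score x k) has_real_derivative ((?s (k - 1) * ?P (k - 1) + ?s (k + 1) * ?P (k + 1)) * (2 * ?P k)
       - (?P (k - 1) + ?P (k + 1)) * (2 * (?s k * ?P k))) / (2 * ?P k)\<^sup>2) (at x)"
    using DERIV_cong_ev[OF refl _ refl] by fast
  note DERIV_unique[OF skellam_score_has_deriv[OF assms] this]
  moreover have "2 * d * p = a * (s1 - s) + b * (s2 - s)"
    if "d = ((s1 * a + s2 * b) * (2 * p) - (a + b) * (2 * (s * p))) / (2 * p)\<^sup>2" "p \<noteq> 0"
    for a b d p s s1 s2 :: real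
    unfolding that(1) using that(2) by (simp add: field_simps power2_eq_square)
  ultimately show ?thesis
    using ne by blast
qed

lemma skellam_score_bound:
  assumes "0 < a" "a \<le> x" "x \<le> b"
  shows "\<bar>skellam_score x k\<bar> \<le> (1 + b + 1 / a) * (1 + \<bar>real_of_int k\<bar>)"
proof -
  have r: "0 \<le> bessel_ratio (nat \<bar>k\<bar>) x" "bessel_ratio (nat \<bar>k\<bar>) x \<le> b"
    using bessel_ratio_nonneg[of x] bessel_ratio_le[of x "nat \<bar>k\<bar>"] assms by auto
  have "\<bar>real_of_int k\<bar> / x \<le> \<bar>real_of_int k\<bar> / a" "0 \<le> \<bar>real_of_int k\<bar> / x"
    using assms by (auto intro!: divide_left_mono)
  then have "\<bar>skellam_score x k\<bar> \<le> 1 + b + \<bar>real_of_int k\<bar> / a"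
    using r unfolding skellam_score_def by linarith
  also have "\<dots> \<le> (1 + b + 1 / a) * (1 + \<bar>real_of_int k\<bar>)"
    using assms by (simp add: algebra_simps)
  finally show ?thesis .
qed

text \<open>All Bessel quotients lie in \<open>[0, b]\<close>, so the first summand is bounded in k
  and only \<open>|k| / x^2\<close> grows.\<close>

lemma skellam_score_deriv_bound:
  assumes "0 < a" "a \<le> x" "x \<le> b"
  shows "\<bar>skellam_score_deriv x k\<bar> \<le> (b * (2 * b + 1 / a) + 1 / a\<^sup>2) * (1 + \<bar>real_of_int k\<bar>)"
proof -
  have r: "0 \<le> bessel_ratio n x" "bessel_ratio n x \<le> b" for n
    using bessel_ratio_nonneg[of x] bessel_ratio_le[of x n] assms by auto
  have a: "0 \<le> 1 / x" "1 / x \<le> 1 / a" using assms by (auto intro!: divide_left_mono)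
  have k: "\<bar>real_of_int k\<bar> / x\<^sup>2 \<le> \<bar>real_of_int k\<bar> / a\<^sup>2" "0 \<le> \<bar>real_of_int k\<bar> / x\<^sup>2"
    using assms by (auto intro!: divide_left_mono power_mono)
  have h: "\<bar>bessel_ratio n x * (bessel_ratio (Suc n) x - bessel_ratio n x + 1 / x)\<bar> \<le> b * (2 * b + 1 / a)" for n
    unfolding abs_mult
  proof (rule mult_mono)
    show "\<bar>bessel_ratio (Suc n) x - bessel_ratio n x + 1 / x\<bar> \<le> 2 * b + 1 / a"
      using r[of n] r[of "Suc n"] a by linarith
  qed (use r[of n] in auto)
  have "\<bar>skellam_score_deriv x k\<bar> \<le> b * (2 * b + 1 / a) + \<bar>real_of_int k\<bar> / a\<^sup>2"
  proof -
    have "\<bar>u - w\<bar> \<le> p + q" if "\<bar>u\<bar> \<le> p" "w \<le> q" "0 \<le> w" for u w p q :: real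
      using that by linarith
    from this[OF h k] show ?thesis
      unfolding skellam_score_deriv_def Let_def .
  qed
  \<comment> \<open>Nonnegative cross terms are added so that the sum factors.\<close>
  also have "\<dots> \<le> b * (2 * b + 1 / a) + \<bar>real_of_int k\<bar> / a\<^sup>2 + (b * (2 * b + 1 / a) * \<bar>real_of_int k\<bar> + 1 / a\<^sup>2)"
    using assms by simp
  also have "\<dots> = (b * (2 * b + 1 / a) + 1 / a\<^sup>2) * (1 + \<bar>real_of_int k\<bar>)"
    by (simp add: algebra_simps add_divide_distrib)
  finally show ?thesis .
qed

section \<open>Sums over i.i.d. samples\<close>

lemma pmf_iid_pmf:
  "pmf (iid_pmf n p) xs = (if length xs = n then prod_list (map (pmf p) xs) else 0)"
proof (induction n arbitrary: xs)
  case 0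
  then show ?case by (auto simp: indicator_def)
next
  case (Suc n)
  have eq: "iid_pmf (Suc n) p = map_pmf (\<lambda>(x, xs). x # xs) (pair_pmf p (iid_pmf n p))"
    by (simp add: map_pmf_def pair_pmf_def bind_assoc_pmf bind_return_pmf)
  show ?case
  proof (cases xs)
    case Nil
    have "xs \<notin> set_pmf (iid_pmf (Suc n) p)"
      unfolding eq Nil by auto
    then have "pmf (iid_pmf (Suc n) p) xs = 0" by (simp only: set_pmf_iff simp_thms)
    then show ?thesis using Nil by simp
  next
    case (Cons y ys)
    have inj: "inj (\<lambda>(x, xs). x # xs)" by (auto simp: inj_def)
    have "pmf (iid_pmf (Suc n) p) xs = pmf (map_pmf (\<lambda>(x, xs). x # xs) (pair_pmf p (iid_pmf n p))) ((\<lambda>(x, xs). x # xs) (y, ys))"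
      unfolding eq Cons by simp
    also have "\<dots> = pmf p y * pmf (iid_pmf n p) ys"
      by (subst pmf_map_inj'[OF inj]) (simp add: pmf_pair)
    finally show ?thesis using Cons Suc.IH by simp
  qed
qed

lemma set_pmf_iid_pmf: "set_pmf (iid_pmf n p) = {xs. length xs = n \<and> set xs \<subseteq> set_pmf p}"
  by (auto simp: set_pmf_eq pmf_iid_pmf prod_list_zero_iff)

text \<open>Presents the i.i.d. list as the reading of a product measure on functions, from which
  independence of the coordinates is inherited. The value d fills the coordinates outside
  \<open>{..<n}\<close>.\<close>

lemma iid_pmf_eq_map_Pi_pmf:
  "iid_pmf n p = map_pmf (\<lambda>f. map f [0..<n]) (Pi_pmf {..<n} d (\<lambda>_. p))"
proof (rule pmf_eqI)
  fix xs :: "'a list"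
  let ?P = "Pi_pmf {..<n} d (\<lambda>_. p)"
  show "pmf (iid_pmf n p) xs = pmf (map_pmf (\<lambda>f. map f [0..<n]) ?P) xs"
  proof (cases "length xs = n")
    case False
    then have "xs \<notin> set_pmf (map_pmf (\<lambda>f. map f [0..<n]) ?P)" by auto
    then have "pmf (map_pmf (\<lambda>f. map f [0..<n]) ?P) xs = 0" by (simp only: set_pmf_iff simp_thms)
    then show ?thesis using False by (simp add: pmf_iid_pmf)
  next
    case True
    define f where "f i = (if i < n then xs ! i else d)" for i
    have xs: "xs = map f [0..<n]"
      using True by (auto intro!: nth_equalityI simp: f_def)
    \<comment> \<open>Reading off a list forgets coordinates from n on, so injectivity holds only
      among functions equal to d there; these carry the whole mass.\<close>
    have inj: "inj_on (\<lambda>f. map f [0..<n]) {f. \<forall>x. x \<notin> {..<n} \<longrightarrow> f x = d}"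
    proof (rule inj_onI, rule ext)
      fix f g :: "nat \<Rightarrow> 'a" and i
      assume "f \<in> {f. \<forall>x. x \<notin> {..<n} \<longrightarrow> f x = d}" "g \<in> {f. \<forall>x. x \<notin> {..<n} \<longrightarrow> f x = d}"
        "map f [0..<n] = map g [0..<n]"
      then show "f i = g i" by (cases "i < n") auto
    qed
    have "pmf (map_pmf (\<lambda>f. map f [0..<n]) ?P) xs = measure ?P {f}"
      unfolding pmf_map
    proof (rule measure_pmf.finite_measure_eq_AE)
      show "AE g in measure_pmf ?P. (g \<in> (\<lambda>f. map f [0..<n]) -` {xs}) = (g \<in> {f})"
      proof (rule AE_pmfI)
        fix g assume "g \<in> set_pmf ?P"
        then have g: "g \<in> {f. \<forall>x. x \<notin> {..<n} \<longrightarrow> f x = d}"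
          using set_Pi_pmf_subset[of "{..<n}" d "\<lambda>_. p"] by blast
        have f: "f \<in> {f. \<forall>x. x \<notin> {..<n} \<longrightarrow> f x = d}"
          by (simp add: f_def)
        show "(g \<in> (\<lambda>f. map f [0..<n]) -` {xs}) = (g \<in> {f})"
          using inj_on_eq_iff[OF inj g f] unfolding xs by simp
      qed
    qed auto
    also have "\<dots> = pmf ?P f" by (simp add: measure_pmf_single)
    also have "\<dots> = (\<Prod>i<n. pmf p (xs ! i))"
      by (subst pmf_Pi') (auto simp: f_def)
    also have "\<dots> = prod_list (map (pmf p) xs)"
      using True by (simp add: prod.list_conv_set_nth atLeast0LessThan)
    finally show ?thesis using True by (simp add: pmf_iid_pmf)
  qed
qed

lemma sum_list_map_upt: "sum_list (map g (map f [0..<n])) = (\<Sum>i<n. g (f i))"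
  for g :: "'a \<Rightarrow> 'b::comm_monoid_add"
  by (simp add: sum_list_sum_nth atLeast0LessThan)

section \<open>Characteristic function and second moment of an i.i.d. sum\<close>

lemma indep_vars_Pi_pmf_comp:
  fixes g :: "'a \<Rightarrow> real"
  shows "prob_space.indep_vars (measure_pmf (Pi_pmf {..<(n::nat)} d (\<lambda>_. p))) (\<lambda>_. borel) (\<lambda>i f. g (f i)) {..<n}"
  by (rule prob_space.indep_vars_compose2[OF measure_pmf.prob_space_axioms indep_vars_Pi_pmf[of "{..<n}" d "\<lambda>_. p"]]) simp_all

lemma Pi_pmf_component_lessThan: "i < (n::nat) \<Longrightarrow> map_pmf (\<lambda>f. f i) (Pi_pmf {..<n} d (\<lambda>_. p)) = p"
  using Pi_pmf_component[of "{..<n}" i d "\<lambda>_. p"] by simp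

lemma char_iid_sum:
  fixes g :: "'a \<Rightarrow> real"
  shows "char (distr (measure_pmf (iid_pmf n p)) borel (\<lambda>xs. sum_list (map g xs))) t =
    (measure_pmf.expectation p (\<lambda>x. iexp (t * g x))) ^ n"
proof -
  fix d :: 'a
  let ?P = "Pi_pmf {..<n} d (\<lambda>_. p)"
  have "char (distr (measure_pmf (iid_pmf n p)) borel (\<lambda>xs. sum_list (map g xs))) t =
     char (distr (measure_pmf ?P) borel (\<lambda>f. \<Sum>i<n. g (f i))) t"
    unfolding iid_pmf_eq_map_Pi_pmf[of n p d]
    by (simp add: map_pmf_rep_eq distr_distr comp_def sum_list_map_upt flip: map_map)
  also have "\<dots> = (\<Prod>i<n. char (distr (measure_pmf ?P) borel (\<lambda>f. g (f i))) t)"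
    by (rule prob_space.char_distr_sum[OF measure_pmf.prob_space_axioms indep_vars_Pi_pmf_comp])
  also have "\<dots> = (\<Prod>i<n. measure_pmf.expectation p (\<lambda>x. iexp (t * g x)))"
  proof (rule prod.cong[OF refl])
    fix i assume "i \<in> {..<n}"
    then have "measure_pmf.expectation p (\<lambda>x. iexp (t * g x)) =
       measure_pmf.expectation (map_pmf (\<lambda>f. f i) ?P) (\<lambda>x. iexp (t * g x))"
      by (simp add: Pi_pmf_component_lessThan)
    then show "char (distr (measure_pmf ?P) borel (\<lambda>f. g (f i))) t = measure_pmf.expectation p (\<lambda>x. iexp (t * g x))"
      by (simp add: char_def integral_distr)
  qed
  finally show ?thesis by simp
qed

text \<open>The exact value is n times the variance plus the squared shifted mean; bounding the
  variance by the second moment gives the inequality.\<close>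

lemma iid_sum_second_moment:
  fixes g :: "'a \<Rightarrow> real"
  assumes int2: "integrable (measure_pmf p) (\<lambda>x. (g x)\<^sup>2)"
  defines "m \<equiv> measure_pmf.expectation p g"
  shows "integrable (measure_pmf (iid_pmf n p)) (\<lambda>xs. (sum_list (map g xs) + a)\<^sup>2)"
    and "measure_pmf.expectation (iid_pmf n p) (\<lambda>xs. (sum_list (map g xs) + a)\<^sup>2) \<le>
       real n * measure_pmf.expectation p (\<lambda>x. (g x)\<^sup>2) + (real n * m + a)\<^sup>2"
proof -
  fix d :: 'a
  let ?P = "Pi_pmf {..<n} d (\<lambda>_. p)"
  let ?E = "measure_pmf.expectation ?P"
  have int1: "integrable (measure_pmf p) g"
    by (rule measure_pmf.square_integrable_imp_integrable[OF _ int2]) simp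
  have comp: "integrable (measure_pmf ?P) (\<lambda>f. u (f i)) \<and> ?E (\<lambda>f. u (f i)) = measure_pmf.expectation p u"
    if "i < n" "integrable (measure_pmf p) u" for i and u :: "'a \<Rightarrow> real"
  proof -
    have *: "integrable (map_pmf (\<lambda>f. f i) ?P) u" "measure_pmf.expectation (map_pmf (\<lambda>f. f i) ?P) u = measure_pmf.expectation p u"
      using that by (simp_all only: Pi_pmf_component_lessThan)
    from * show ?thesis by (simp add: map_pmf_rep_eq integrable_distr_eq integral_distr)
  qed
  have prod: "integrable (measure_pmf ?P) (\<lambda>f. g (f i) * g (f j)) \<and> ?E (\<lambda>f. g (f i) * g (f j)) =
     (if i = j then measure_pmf.expectation p (\<lambda>x. (g x)\<^sup>2) else m * m)" if "i < n" "j < n" for i j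
  proof (cases "i = j")
    case True
    then show ?thesis using comp[OF that(1) int2] by (simp add: power2_eq_square)
  next
    case False
    have ind: "prob_space.indep_vars (measure_pmf ?P) (\<lambda>_. borel) (\<lambda>i f. g (f i)) {i, j}"
      by (rule prob_space.indep_vars_subset[OF measure_pmf.prob_space_axioms indep_vars_Pi_pmf_comp]) (use that in auto)
    have "integrable (measure_pmf ?P) (\<lambda>f. \<Prod>i\<in>{i,j}. g (f i))"
      by (rule prob_space.indep_vars_integrable[OF measure_pmf.prob_space_axioms _ ind]) (use comp int1 that in auto)
    moreover have "?E (\<lambda>f. \<Prod>i\<in>{i,j}. g (f i)) = (\<Prod>i\<in>{i,j}. ?E (\<lambda>f. g (f i)))"
      by (rule prob_space.indep_vars_lebesgue_integral[OF measure_pmf.prob_space_axioms _ ind]) (use comp int1 that in auto)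
    ultimately show ?thesis using False comp[OF _ int1] that by (simp add: m_def)
  qed
  have sq: "(sum_list (map g (map f [0..<n])) + a)\<^sup>2 = (\<Sum>i<n. \<Sum>j<n. g (f i) * g (f j)) + 2 * a * (\<Sum>i<n. g (f i)) + a\<^sup>2" for f
    unfolding sum_list_map_upt by (simp add: power2_sum power2_eq_square sum_product algebra_simps)
  have I: "integrable (measure_pmf ?P) (\<lambda>f. (sum_list (map g (map f [0..<n])) + a)\<^sup>2)"
    unfolding sq using prod comp[OF _ int1] by (intro Bochner_Integration.integrable_add Bochner_Integration.integrable_sum integrable_mult_right) auto
  then show "integrable (measure_pmf (iid_pmf n p)) (\<lambda>xs. (sum_list (map g xs) + a)\<^sup>2)"
    unfolding iid_pmf_eq_map_Pi_pmf[of n p d] by (simp add: map_pmf_rep_eq integrable_distr_eq flip: map_map)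
  have "measure_pmf.expectation (iid_pmf n p) (\<lambda>xs. (sum_list (map g xs) + a)\<^sup>2) = ?E (\<lambda>f. (sum_list (map g (map f [0..<n])) + a)\<^sup>2)"
    unfolding iid_pmf_eq_map_Pi_pmf[of n p d] by (simp flip: map_map)
  also have "\<dots> = (\<Sum>i<n. \<Sum>j<n. if i = j then measure_pmf.expectation p (\<lambda>x. (g x)\<^sup>2) else m * m) + 2 * a * (real n * m) + a\<^sup>2"
  proof -
    have i1: "integrable (measure_pmf ?P) (\<lambda>f. \<Sum>i<n. \<Sum>j<n. g (f i) * g (f j))"
      using prod by (intro Bochner_Integration.integrable_sum) auto
    have i2: "integrable (measure_pmf ?P) (\<lambda>f. \<Sum>i<n. g (f i))"
      using comp[OF _ int1] by (intro Bochner_Integration.integrable_sum) auto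
    have e1: "?E (\<lambda>f. \<Sum>i<n. \<Sum>j<n. g (f i) * g (f j)) =
       (\<Sum>i<n. \<Sum>j<n. if i = j then measure_pmf.expectation p (\<lambda>x. (g x)\<^sup>2) else m * m)"
      using prod by (subst Bochner_Integration.integral_sum;
        (intro Bochner_Integration.integrable_sum sum.cong refl)?;
        (subst Bochner_Integration.integral_sum)?; (intro sum.cong refl)?; auto)
    have e2: "?E (\<lambda>f. \<Sum>i<n. g (f i)) = real n * m"
      using comp[OF _ int1] by (subst Bochner_Integration.integral_sum) (auto simp: m_def)
    show ?thesis
      unfolding sq using i1 i2 e1 e2 by simp
  qed
  also have "(\<Sum>i<n. \<Sum>j<n. if i = j then measure_pmf.expectation p (\<lambda>x. (g x)\<^sup>2) else m * m) \<le>
     (\<Sum>i<n. \<Sum>j<n. m * m + (if i = j then measure_pmf.expectation p (\<lambda>x. (g x)\<^sup>2) else 0))"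
    \<comment> \<open>Granting \<open>m * m\<close> to the diagonal entries too completes the square
      \<open>(n * m)^2\<close>; this is where the variance is replaced by the second moment.\<close>
    by (intro sum_mono) auto
  also have "\<dots> = real n * measure_pmf.expectation p (\<lambda>x. (g x)\<^sup>2) + (real n * m)\<^sup>2"
    by (simp add: sum.distrib power2_eq_square algebra_simps)
  also have "real n * measure_pmf.expectation p (\<lambda>x. (g x)\<^sup>2) + (real n * m)\<^sup>2 + 2 * a * (real n * m) + a\<^sup>2 =
       real n * measure_pmf.expectation p (\<lambda>x. (g x)\<^sup>2) + (real n * m + a)\<^sup>2"
    by (simp add: power2_sum)
  finally show "measure_pmf.expectation (iid_pmf n p) (\<lambda>xs. (sum_list (map g xs) + a)\<^sup>2) \<le>
       real n * measure_pmf.expectation p (\<lambda>x. (g x)\<^sup>2) + (real n * m + a)\<^sup>2"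
    by simp
qed

text \<open>Markov's inequality for the square. The free shift a allows deviations from a prescribed
  value instead of the mean; it will be \<open>v^2 / 2\<close>.\<close>

lemma iid_sum_Chebyshev:
  fixes g :: "'a \<Rightarrow> real"
  assumes int2: "integrable (measure_pmf p) (\<lambda>x. (g x)\<^sup>2)" and "e > 0"
  shows "measure_pmf.prob (iid_pmf n p) {xs. \<bar>sum_list (map g xs) + a\<bar> > e} \<le>
    (real n * measure_pmf.expectation p (\<lambda>x. (g x)\<^sup>2) + (real n * measure_pmf.expectation p g + a)\<^sup>2) / e\<^sup>2"
proof -
  have "measure_pmf.prob (iid_pmf n p) {xs. \<bar>sum_list (map g xs) + a\<bar> > e} \<le>
     measure_pmf.prob (iid_pmf n p) {xs \<in> space (measure_pmf (iid_pmf n p)). e\<^sup>2 \<le> (sum_list (map g xs) + a)\<^sup>2}"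
    using \<open>e > 0\<close> by (intro measure_pmf.finite_measure_mono) (auto simp: abs_le_square_iff[symmetric])
  also have "\<dots> \<le> measure_pmf.expectation (iid_pmf n p) (\<lambda>xs. (sum_list (map g xs) + a)\<^sup>2) / e\<^sup>2"
    by (rule integral_Markov_inequality_measure[where A = "UNIV", simplified])
       (use \<open>e > 0\<close> iid_sum_second_moment(1)[OF int2] in auto)
  also have "\<dots> \<le> (real n * measure_pmf.expectation p (\<lambda>x. (g x)\<^sup>2) + (real n * measure_pmf.expectation p g + a)\<^sup>2) / e\<^sup>2"
    by (intro divide_right_mono iid_sum_second_moment(2)[OF int2]) auto
  finally show ?thesis .
qed

section \<open>Expectations under the Skellam law\<close>

lemma expectation_skellam:
  fixes f :: "int \<Rightarrow> 'b::{banach, second_countable_topology}"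
  shows "measure_pmf.expectation (skellam_pmf x) f = (\<integral>k. pmf (skellam_pmf x) k *\<^sub>R f k \<partial>count_space UNIV)"
  by (simp add: measure_pmf_eq_density integral_density)

text \<open>Dominates, for all \<open>0 < x \<le> b\<close> at once, the Skellam weight times \<open>(1 + |k|)\<^sup>2\<close>.\<close>

definition skellam_majorant :: "real \<Rightarrow> int \<Rightarrow> real" where
  "skellam_majorant b k = exp (b\<^sup>2 / 4) * (b / 2) ^ nat \<bar>k\<bar> / fact (nat \<bar>k\<bar>) * (1 + \<bar>real_of_int k\<bar>)\<^sup>2"

lemma integrable_skellam_majorant:
  assumes "b > 0"
  shows "integrable (count_space UNIV) (skellam_majorant b)"
proof -
  define d where "d n = exp (b\<^sup>2 / 4) * (b / 2) ^ n / fact n * (1 + real n)\<^sup>2" for n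
  have maj: "skellam_majorant b k = d (nat \<bar>k\<bar>)" for k
    by (simp add: skellam_majorant_def d_def)
  have "Infinite_Set_Sum.abs_summable_on d UNIV"
  proof (rule Infinite_Set_Sum.abs_summable_on_comparison_test')
    show "Infinite_Set_Sum.abs_summable_on (\<lambda>n. exp (b\<^sup>2 / 4) * (inverse (fact n) * (2 * b) ^ n)) UNIV"
      unfolding Infinite_Set_Sum.abs_summable_on_nat_iff'
      using summable_mult[OF summable_exp[of "2 * b"], of "exp (b\<^sup>2 / 4)"] \<open>b > 0\<close> by (simp add: abs_mult)
    fix n
    \<comment> \<open>The quadratic factor is absorbed into \<open>4 ^ n\<close>, which turns
      \<open>b/2\<close> into \<open>2 * b\<close> in an exponential series.\<close>
    have "1 + real n \<le> 2 ^ n"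
      by (induction n) auto
    then have "(1 + real n)\<^sup>2 \<le> (2 ^ n)\<^sup>2"
      by (intro power_mono) auto
    also have "\<dots> = 4 ^ n"
      by (simp add: power2_eq_square flip: power_mult_distrib)
    finally have "d n \<le> exp (b\<^sup>2 / 4) * (b / 2) ^ n / fact n * 4 ^ n"
      unfolding d_def using \<open>b > 0\<close> by (intro mult_left_mono) auto
    also have "\<dots> = exp (b\<^sup>2 / 4) * (inverse (fact n) * ((b / 2) ^ n * 4 ^ n))"
      by (simp only: divide_inverse mult.assoc mult.left_commute[of "inverse (fact n)"])
    also have "(b / 2) ^ n * 4 ^ n = (b / 2 * 4) ^ n"
      by (rule power_mult_distrib[symmetric])
    also have "b / 2 * 4 = 2 * b" by simp
    finally show "norm (d n) \<le> exp (b\<^sup>2 / 4) * (inverse (fact n) * (2 * b) ^ n)"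
      using \<open>b > 0\<close> by (simp add: d_def)
  qed
  \<comment> \<open>The integers are covered by the images of n and -n; absolute summability on a
    union tolerates the overlap at 0.\<close>
  then have "Infinite_Set_Sum.abs_summable_on (skellam_majorant b) (range int)"
    "Infinite_Set_Sum.abs_summable_on (skellam_majorant b) (range (\<lambda>n. - int n))"
    by (auto intro!: Infinite_Set_Sum.abs_summable_on_reindex simp: maj)
  then have "Infinite_Set_Sum.abs_summable_on (skellam_majorant b) (range int \<union> range (\<lambda>n. - int n))"
    by (rule Infinite_Set_Sum.abs_summable_on_union)
  moreover have "k \<in> range int \<union> range (\<lambda>n. - int n)" for k
    by (cases k rule: int_cases2) auto
  then have "range int \<union> range (\<lambda>n. - int n) = UNIV" by blast
  ultimately show ?thesis
    by (simp add: Infinite_Set_Sum.abs_summable_on_def)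
qed

text \<open>Dropping \<open>exp (- x)\<close> leaves the Bessel bound, which is increasing in x and
  hence controlled by its value at b.\<close>

lemma norm_pmf_skellam_le_majorant:
  assumes "0 < x" "x \<le> b" "norm v \<le> C * (1 + \<bar>real_of_int k\<bar>)\<^sup>2"
  shows "norm (pmf (skellam_pmf x) k *\<^sub>R v) \<le> C * skellam_majorant b k"
proof -
  have C: "C \<ge> 0"
  proof -
    have "0 \<le> C * (1 + \<bar>real_of_int k\<bar>)\<^sup>2" using norm_ge_zero[of v] assms(3) by linarith
    moreover have "(1 + \<bar>real_of_int k\<bar>)\<^sup>2 > 0" by (intro zero_less_power) auto
    ultimately show ?thesis by (simp add: zero_le_mult_iff)
  qed
  have "pmf (skellam_pmf x) k \<le> bessel_I (nat \<bar>k\<bar>) x"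
    using bessel_I_pos[OF \<open>0 < x\<close>, of "nat \<bar>k\<bar>"] \<open>0 < x\<close> by (simp add: pmf_skellam)
  also have "\<dots> \<le> exp (x\<^sup>2 / 4) * (x / 2) ^ nat \<bar>k\<bar> / fact (nat \<bar>k\<bar>)"
    using assms by (intro bessel_I_le) auto
  also have "\<dots> \<le> exp (b\<^sup>2 / 4) * (b / 2) ^ nat \<bar>k\<bar> / fact (nat \<bar>k\<bar>)"
    using assms by (intro divide_right_mono mult_mono power_mono) auto
  finally have "norm (pmf (skellam_pmf x) k *\<^sub>R v) \<le>
     exp (b\<^sup>2 / 4) * (b / 2) ^ nat \<bar>k\<bar> / fact (nat \<bar>k\<bar>) * (C * (1 + \<bar>real_of_int k\<bar>)\<^sup>2)"
    unfolding norm_scaleR abs_of_nonneg[OF pmf_nonneg]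
    using assms by (intro mult_mono) auto
  then show ?thesis
    by (simp add: skellam_majorant_def mult_ac)
qed

lemma integrable_skellam_count:
  fixes f :: "int \<Rightarrow> 'b::{banach, second_countable_topology}"
  assumes "x > 0" "\<And>k. norm (f k) \<le> C * (1 + \<bar>real_of_int k\<bar>)\<^sup>2"
  shows "integrable (count_space UNIV) (\<lambda>k. pmf (skellam_pmf x) k *\<^sub>R f k)"
proof (rule Bochner_Integration.integrable_bound)
  show "integrable (count_space UNIV) (\<lambda>k. C * skellam_majorant x k)"
    by (intro integrable_mult_right integrable_skellam_majorant assms)
  show "AE k in count_space UNIV. norm (pmf (skellam_pmf x) k *\<^sub>R f k) \<le> norm (C * skellam_majorant x k)"
    by (intro AE_I2 order_trans[OF norm_pmf_skellam_le_majorant[OF assms(1) order_refl assms(2)]])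
       (simp only: real_norm_def abs_ge_self)
qed simp

lemma integrable_skellam:
  fixes f :: "int \<Rightarrow> 'b::{banach, second_countable_topology}"
  assumes "x > 0" "\<And>k. norm (f k) \<le> C * (1 + \<bar>real_of_int k\<bar>)\<^sup>2"
  shows "integrable (measure_pmf (skellam_pmf x)) f"
  using integrable_skellam_count[OF assms] by (simp add: measure_pmf_eq_density integrable_density)

text \<open>Law and integrand vary together, so dominated convergence is applied over the counting
  measure with the weights inside the integrand. Eventually \<open>l n < 2 * x\<close>, which makes
  \<open>skellam_majorant (2 * x)\<close> a common bound.\<close>

lemma skellam_tendsto_expectation:
  fixes f :: "nat \<Rightarrow> int \<Rightarrow> 'b::{banach, second_countable_topology}"
  assumes l: "l \<longlonglongrightarrow> x" and x: "x > 0"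
    and f: "\<And>k. (\<lambda>n. f n k) \<longlonglongrightarrow> g k"
    and bnd: "\<forall>\<^sub>F n in sequentially. \<forall>k. norm (f n k) \<le> C * (1 + \<bar>real_of_int k\<bar>)\<^sup>2"
  shows "(\<lambda>n. measure_pmf.expectation (skellam_pmf (l n)) (f n)) \<longlonglongrightarrow> measure_pmf.expectation (skellam_pmf x) g"
proof -
  have "\<forall>\<^sub>F n in sequentially. 0 < l n \<and> l n < 2 * x"
    using order_tendstoD[OF l, of 0] order_tendstoD[OF l, of "2 * x"] x
    by (simp add: eventually_conj_iff)
  with bnd have "\<forall>\<^sub>F n in sequentially. (0 < l n \<and> l n < 2 * x) \<and> (\<forall>k. norm (f n k) \<le> C * (1 + \<bar>real_of_int k\<bar>)\<^sup>2)"
    by eventually_elim blast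
  then obtain m where m: "\<And>n. n \<ge> m \<Longrightarrow> 0 < l n \<and> l n < 2 * x \<and> (\<forall>k. norm (f n k) \<le> C * (1 + \<bar>real_of_int k\<bar>)\<^sup>2)"
    unfolding eventually_sequentially by blast
  \<comment> \<open>The shift by m discards the indices at which the domination may fail.\<close>
  have "(\<lambda>n. \<integral>k. pmf (skellam_pmf (l (n + m))) k *\<^sub>R f (n + m) k \<partial>count_space UNIV) \<longlonglongrightarrow>
     (\<integral>k. pmf (skellam_pmf x) k *\<^sub>R g k \<partial>count_space UNIV)"
  proof (rule integral_dominated_convergence)
    show "integrable (count_space UNIV) (\<lambda>k. C * skellam_majorant (2 * x) k)"
      using x by (intro integrable_mult_right integrable_skellam_majorant) auto
    show "AE k in count_space UNIV. (\<lambda>n. pmf (skellam_pmf (l (n + m))) k *\<^sub>R f (n + m) k) \<longlonglongrightarrow> pmf (skellam_pmf x) k *\<^sub>R g k"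
    proof (rule AE_I2)
      fix k
      have "isCont (\<lambda>x. pmf (skellam_pmf x) k) x"
        by (rule DERIV_isCont[OF pmf_skellam_has_deriv[OF x]])
      from isCont_tendsto_compose[OF this l] have "(\<lambda>n. pmf (skellam_pmf (l n)) k *\<^sub>R f n k) \<longlonglongrightarrow> pmf (skellam_pmf x) k *\<^sub>R g k"
        by (intro tendsto_scaleR f)
      then show "(\<lambda>n. pmf (skellam_pmf (l (n + m))) k *\<^sub>R f (n + m) k) \<longlonglongrightarrow> pmf (skellam_pmf x) k *\<^sub>R g k"
        by (rule LIMSEQ_ignore_initial_segment)
    qed
    show "AE k in count_space UNIV. norm (pmf (skellam_pmf (l (n + m))) k *\<^sub>R f (n + m) k) \<le> C * skellam_majorant (2 * x) k" for n
      using m[of "n + m"] by (intro AE_I2 norm_pmf_skellam_le_majorant) auto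
  qed auto
  then show ?thesis
    unfolding expectation_skellam by (rule LIMSEQ_offset)
qed

lemma linear_growth_imp_quadratic:
  assumes "\<bar>u\<bar> \<le> C * (1 + \<bar>real_of_int k\<bar>)"
  shows "\<bar>u\<bar> \<le> C * (1 + \<bar>real_of_int k\<bar>)\<^sup>2" "u\<^sup>2 \<le> C\<^sup>2 * (1 + \<bar>real_of_int k\<bar>)\<^sup>2"
proof -
  have "0 \<le> C * (1 + \<bar>real_of_int k\<bar>)" using assms abs_ge_zero[of u] by linarith
  moreover have "1 + \<bar>real_of_int k\<bar> > 0" by linarith
  ultimately have C: "C \<ge> 0" by (simp add: zero_le_mult_iff)
  have "(1 + \<bar>real_of_int k\<bar>) \<le> (1 + \<bar>real_of_int k\<bar>)\<^sup>2" by (rule self_le_power) auto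
  with C assms show "\<bar>u\<bar> \<le> C * (1 + \<bar>real_of_int k\<bar>)\<^sup>2"
    by (meson mult_left_mono order_trans)
  show "u\<^sup>2 \<le> C\<^sup>2 * (1 + \<bar>real_of_int k\<bar>)\<^sup>2"
    using power_mono[OF assms, of 2] by (simp add: power_mult_distrib)
qed

lemma integrable_skellam_score:
  assumes "x > 0"
  shows "integrable (measure_pmf (skellam_pmf x)) (skellam_score x)"
    "integrable (measure_pmf (skellam_pmf x)) (\<lambda>k. (skellam_score x k)\<^sup>2)"
    "integrable (measure_pmf (skellam_pmf x)) (skellam_score_deriv x)"
proof -
  note s = linear_growth_imp_quadratic[OF skellam_score_bound[OF assms order_refl order_refl]]
  note d = linear_growth_imp_quadratic[OF skellam_score_deriv_bound[OF assms order_refl order_refl]]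
  show "integrable (measure_pmf (skellam_pmf x)) (skellam_score x)"
    by (rule integrable_skellam[OF assms]) (simp only: real_norm_def, rule s(1))
  show "integrable (measure_pmf (skellam_pmf x)) (\<lambda>k. (skellam_score x k)\<^sup>2)"
    by (rule integrable_skellam[OF assms]) (simp only: real_norm_def abs_power2, rule s(2))
  show "integrable (measure_pmf (skellam_pmf x)) (skellam_score_deriv x)"
    by (rule integrable_skellam[OF assms]) (simp only: real_norm_def, rule d(1))
qed

section \<open>Score identities by translation, and positive information\<close>

lemma skellam_shift:
  assumes "integrable (measure_pmf (skellam_pmf x)) (f :: int \<Rightarrow> real)"
  shows "has_bochner_integral (count_space UNIV) (\<lambda>k. pmf (skellam_pmf x) (k + a) * f (k + a))
    (measure_pmf.expectation (skellam_pmf x) f)"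
proof -
  have bij: "bij_betw (\<lambda>k. k + a) (UNIV :: int set) UNIV"
    by (rule bij_betw_byWitness[where f' = "\<lambda>k. k - a"]) auto
  have int: "integrable (count_space UNIV) (\<lambda>k. pmf (skellam_pmf x) k * f k)"
    using assms by (simp add: measure_pmf_eq_density integrable_density)
  show ?thesis
    using integrable_bij_count_space[OF bij, of "\<lambda>k. pmf (skellam_pmf x) k * f k"] int
      integral_bij_count_space[OF bij, of "\<lambda>k. pmf (skellam_pmf x) k * f k"]
    by (simp add: has_bochner_integral_iff expectation_skellam)
qed

text \<open>By the neighbour identity \<open>s p\<close> is the average of two translates of p minus
  p itself, and each of the three has total mass 1. Nothing is differentiated under the sum.\<close>

lemma expectation_skellam_score:
  assumes x: "x > 0"
  shows "measure_pmf.expectation (skellam_pmf x) (skellam_score x) = 0"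
proof -
  note shift = skellam_shift[of x "\<lambda>_. 1", simplified]
  have "has_bochner_integral (count_space UNIV)
    (\<lambda>k. (pmf (skellam_pmf x) (k + (-1)) + pmf (skellam_pmf x) (k + 1)) / 2 - pmf (skellam_pmf x) (k + 0)) ((1 + 1) / 2 - 1)"
    by (intro has_bochner_integral_diff has_bochner_integral_divide_zero has_bochner_integral_add shift)
  also have "(\<lambda>k. (pmf (skellam_pmf x) (k + (-1)) + pmf (skellam_pmf x) (k + 1)) / 2 - pmf (skellam_pmf x) (k + 0)) =
    (\<lambda>k. pmf (skellam_pmf x) k * skellam_score x k)"
    using pmf_skellam_neighbours[OF x] by (simp add: fun_eq_iff algebra_simps)
  finally show ?thesis
    by (simp add: expectation_skellam has_bochner_integral_iff)
qed

text \<open>The two neighbour identities write \<open>s' p\<close> as the average of two translates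
  of \<open>s p\<close>, minus \<open>s^2 p\<close>, minus \<open>s p\<close>. The translates sum to
  \<open>E s\<close> and cancel the last term.\<close>

lemma expectation_skellam_score_deriv:
  assumes x: "x > 0"
  shows "measure_pmf.expectation (skellam_pmf x) (skellam_score_deriv x) =
    - measure_pmf.expectation (skellam_pmf x) (\<lambda>k. (skellam_score x k)\<^sup>2)"
proof -
  let ?P = "pmf (skellam_pmf x)" and ?s = "skellam_score x" and ?E = "measure_pmf.expectation (skellam_pmf x)"
  note shift = skellam_shift[OF integrable_skellam_score(1)[OF x]]
  have "has_bochner_integral (count_space UNIV)
    (\<lambda>k. (?P (k + (-1)) * ?s (k + (-1)) + ?P (k + 1) * ?s (k + 1)) / 2 - ?P (k + 0) * (?s (k + 0))\<^sup>2 - ?P (k + 0) * ?s (k + 0))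
    ((?E ?s + ?E ?s) / 2 - ?E (\<lambda>k. (?s k)\<^sup>2) - ?E ?s)"
    by (intro has_bochner_integral_diff has_bochner_integral_divide_zero has_bochner_integral_add shift
        skellam_shift[OF integrable_skellam_score(2)[OF x]])
  also have "(\<lambda>k. (?P (k + (-1)) * ?s (k + (-1)) + ?P (k + 1) * ?s (k + 1)) / 2 - ?P (k + 0) * (?s (k + 0))\<^sup>2 - ?P (k + 0) * ?s (k + 0)) =
    (\<lambda>k. ?P k * skellam_score_deriv x k)"
  proof
    fix k
    have "d * p = (a * sa + b * sb) / 2 - p * s\<^sup>2 - p * s"
      if "2 * d * p = a * (sa - s) + b * (sb - s)" "a + b = 2 * (s + 1) * p" for a b p d s sa sb :: real
    proof -
      have "2 * d * p = a * sa + b * sb - (a + b) * s" using that(1) by (simp add: algebra_simps)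
      then show ?thesis unfolding that(2) by (simp add: algebra_simps power2_eq_square)
    qed
    from this[OF skellam_score_deriv_neighbours[OF x, of k] pmf_skellam_neighbours[OF x, of k]]
    show "(?P (k + (-1)) * ?s (k + (-1)) + ?P (k + 1) * ?s (k + 1)) / 2 - ?P (k + 0) * (?s (k + 0))\<^sup>2 - ?P (k + 0) * ?s (k + 0)
       = ?P k * skellam_score_deriv x k"
      by (simp add: mult.commute)
  qed
  finally show ?thesis
    by (simp add: expectation_skellam has_bochner_integral_iff)
qed

lemma expectation_skellam_score_square_pos:
  assumes x: "x > 0"
  shows "measure_pmf.expectation (skellam_pmf x) (\<lambda>k. (skellam_score x k)\<^sup>2) > 0"
proof -
  \<comment> \<open>At any \<open>k > x\<close> the score is positive because
    \<open>|k|/x > 1\<close>, and every integer has positive mass, so the score is not almost surely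
    zero.\<close>
  define k :: int where "k = \<lfloor>x\<rfloor> + 1"
  have "real_of_int k > x" unfolding k_def by linarith
  with x have "\<bar>real_of_int k\<bar> / x > 1" by simp
  then have "skellam_score x k > 0"
    using bessel_ratio_nonneg[OF x, of "nat \<bar>k\<bar>"] unfolding skellam_score_def by linarith
  have "measure_pmf.expectation (skellam_pmf x) (\<lambda>k. (skellam_score x k)\<^sup>2) \<noteq> 0"
  proof
    assume "measure_pmf.expectation (skellam_pmf x) (\<lambda>k. (skellam_score x k)\<^sup>2) = 0"
    then have "AE k in measure_pmf (skellam_pmf x). (skellam_score x k)\<^sup>2 = 0"
      by (subst (asm) integral_nonneg_eq_0_iff_AE[OF integrable_skellam_score(2)[OF x]]) auto
    then show False
      using \<open>skellam_score x k > 0\<close> by (auto simp: AE_measure_pmf_iff set_pmf_skellam[OF x])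
  qed
  moreover have "measure_pmf.expectation (skellam_pmf x) (\<lambda>k. (skellam_score x k)\<^sup>2) \<ge> 0"
    by (rule Bochner_Integration.integral_nonneg) simp
  ultimately show ?thesis by linarith
qed

section \<open>Continuity in the parameter and Taylor expansion of the log-likelihood\<close>

lemma tendsto_skellam_score:
  assumes "(l \<longlongrightarrow> x) F" "x > 0"
  shows "((\<lambda>n. skellam_score (l n) k) \<longlongrightarrow> skellam_score x k) F"
  by (rule isCont_tendsto_compose[OF DERIV_isCont[OF skellam_score_has_deriv[OF assms(2)]] assms(1)])

lemma tendsto_skellam_score_deriv:
  assumes "(l \<longlongrightarrow> x) F" "x > 0"
  shows "((\<lambda>n. skellam_score_deriv (l n) k) \<longlongrightarrow> skellam_score_deriv x k) F"
proof -
  have "((\<lambda>n. bessel_ratio m (l n)) \<longlongrightarrow> bessel_ratio m x) F" for m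
    by (rule isCont_tendsto_compose[OF DERIV_isCont[OF bessel_ratio_deriv[OF assms(2)]] assms(1)])
  then show ?thesis
    unfolding skellam_score_deriv_def Let_def using assms by (intro tendsto_intros) auto
qed

lemma skellam_log_ratio_Taylor:
  assumes "x > 0" "x + d > 0"
  obtains y where "\<bar>y - x\<bar> \<le> \<bar>d\<bar>"
    "ln (pmf (skellam_pmf (x + d)) k / pmf (skellam_pmf x) k) - d * skellam_score x k =
     skellam_score_deriv y k * d\<^sup>2 / 2"
proof (cases "d = 0")
  \<comment> \<open>Taylor's theorem asks for two distinct points; for \<open>d = 0\<close> the
    intermediate point is x itself.\<close>
  case True
  then show ?thesis using that[of x] pmf_skellam_pos[OF assms(1), of k] by simp
next
  case False
  define D where "D m y = (if m = 0 then ln (pmf (skellam_pmf y) k) else if m = 1 then skellam_score y k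
     else skellam_score_deriv y k)" for m :: nat and y
  have "\<exists>t. (if x + d < x then x + d < t \<and> t < x else x < t \<and> t < x + d) \<and>
     ln (pmf (skellam_pmf (x + d)) k) = (\<Sum>m<2. D m x / fact m * (x + d - x) ^ m) + D 2 t / fact 2 * (x + d - x) ^ 2"
  proof (rule Taylor)
    show "\<forall>m t. m < 2 \<and> min x (x + d) \<le> t \<and> t \<le> max x (x + d) \<longrightarrow> (D m has_real_derivative D (Suc m) t) (at t)"
    proof (intro allI impI, elim conjE)
      fix m :: nat and t assume m: "m < 2" and t: "min x (x + d) \<le> t"
      then have t: "t > 0" using assms by linarith
      have p: "pmf (skellam_pmf t) k > 0" by (rule pmf_skellam_pos[OF t])
      have 0: "((\<lambda>y. ln (pmf (skellam_pmf y) k)) has_real_derivative skellam_score t k) (at t)"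
        by (rule derivative_eq_intros pmf_skellam_has_deriv p t refl)+ (use p in simp)
      have "m = 0 \<or> m = 1" using m by linarith
      then show "(D m has_real_derivative D (Suc m) t) (at t)"
        using 0 skellam_score_has_deriv[OF t, of k] by (auto simp: D_def[abs_def])
    qed
  qed (use False in \<open>auto simp: D_def\<close>)
  then obtain t where t: "if x + d < x then x + d < t \<and> t < x else x < t \<and> t < x + d"
    "ln (pmf (skellam_pmf (x + d)) k) = (\<Sum>m<2. D m x / fact m * (x + d - x) ^ m) + D 2 t / fact 2 * (x + d - x) ^ 2"
    by blast
  have "(\<Sum>m<2. D m x / fact m * (x + d - x) ^ m) = ln (pmf (skellam_pmf x) k) + skellam_score x k * d"
    by (simp add: D_def numeral_2_eq_2)
  then show ?thesis
    using t that[of t] pmf_skellam_pos[OF assms(1), of k] pmf_skellam_pos[OF assms(2), of k]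
    by (simp add: D_def ln_div mult_ac split: if_splits)
qed

section \<open>Limit theorems for Skellam arrays\<close>

text \<open>Compares \<open>a^N\<close> with \<open>(1 + r/N)^N\<close>. Both bases have modulus at
  most 1, so the powers differ by at most \<open>N\<close> times the difference of the bases, and no
  complex logarithm is needed.\<close>

lemma tendsto_power_exp:
  fixes a :: "nat \<Rightarrow> complex" and N :: "nat \<Rightarrow> nat" and r :: real
  assumes N: "filterlim N at_top sequentially" and a1: "\<And>n. norm (a n) \<le> 1"
    and lim: "(\<lambda>n. of_nat (N n) * (a n - 1)) \<longlonglongrightarrow> of_real r" and "r \<le> 0"
  shows "(\<lambda>n. a n ^ N n) \<longlonglongrightarrow> of_real (exp r)"
proof -
  define b where "b n = (1 + r / real (N n))" for n
  have "(\<lambda>n. (1 + r / real n) ^ n) \<longlonglongrightarrow> exp r" by (rule tendsto_exp_limit_sequentially)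
  from filterlim_compose[OF this N] have "(\<lambda>n. of_real (b n ^ N n)) \<longlonglongrightarrow> (of_real (exp r) :: complex)"
    unfolding b_def by (rule tendsto_of_real)
  moreover have "(\<lambda>n. a n ^ N n - of_real (b n ^ N n)) \<longlonglongrightarrow> 0"
  proof (rule Lim_null_comparison)
    \<comment> \<open>From \<open>N >= |r|\<close> and \<open>r \<le> 0\<close> the base
      \<open>1 + r/N\<close> lies in \<open>[0, 1]\<close>.\<close>
    have "\<forall>\<^sub>F n in sequentially. N n \<ge> nat \<lceil>\<bar>r\<bar>\<rceil> + 1"
      using N by (simp add: filterlim_at_top)
    then show "\<forall>\<^sub>F n in sequentially. norm (a n ^ N n - of_real (b n ^ N n)) \<le> norm (of_nat (N n) * (a n - 1) - of_real r)"
    proof eventually_elim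
      case (elim n)
      then have Nn: "real (N n) \<ge> \<bar>r\<bar>" "N n > 0" by linarith+
      have "0 \<le> b n" "b n \<le> 1"
        using Nn \<open>r \<le> 0\<close> by (auto simp: b_def field_simps)
      then have "norm (a n ^ N n - (of_real (b n)) ^ N n) \<le> N n * norm (a n - of_real (b n))"
        by (intro norm_power_diff a1) (simp only: norm_of_real)
      also have "\<dots> = norm (of_nat (N n) * (a n - of_real (b n)))"
        by (simp add: norm_mult)
      also have "of_nat (N n) * (a n - of_real (b n)) = of_nat (N n) * (a n - 1) - of_real r"
        using Nn by (simp add: b_def field_simps)
      finally show ?case by simp
    qed
    show "(\<lambda>n. norm (of_nat (N n) * (a n - 1) - of_real r)) \<longlonglongrightarrow> 0"
      using LIM_zero[OF lim] by (rule tendsto_norm_zero)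
  qed
  ultimately show ?thesis
    using tendsto_add by fastforce
qed

text \<open>Row n consists of \<open>N n\<close> draws at parameter \<open>l n\<close>;
  \<open>c n\<close> is the size of the local step in x. Since the score has mean 0 and its second
  moment tends to \<phi>, the condition \<open>Nc\<close> makes the variance of the sum of
  \<open>c n\<close> times the score tend to 1.\<close>

locale skellam_array =
  fixes l c :: "nat \<Rightarrow> real" and N :: "nat \<Rightarrow> nat" and x \<phi> :: real
  assumes x: "x > 0" and l: "l \<longlonglongrightarrow> x" and l_pos: "\<And>n. l n > 0"
    and c: "c \<longlonglongrightarrow> 0" and c_pos: "\<And>n. c n > 0"
    and \<phi>_def: "\<phi> = measure_pmf.expectation (skellam_pmf x) (\<lambda>k. (skellam_score x k)\<^sup>2)"
    and N: "filterlim N at_top sequentially"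
    and Nc: "(\<lambda>n. real (N n) * (c n)\<^sup>2) \<longlonglongrightarrow> 1 / \<phi>"
begin

lemma \<phi>_pos: "\<phi> > 0"
  unfolding \<phi>_def by (rule expectation_skellam_score_square_pos[OF x])

lemma eventually_l_near: "\<forall>\<^sub>F n in sequentially. x / 2 < l n \<and> l n < 2 * x"
  using order_tendstoD[OF l, of "x / 2"] order_tendstoD[OF l, of "2 * x"] x
  by (simp add: eventually_conj_iff)

text \<open>Let G be the first-order remainder of \<open>exp (i w)\<close> divided by
  \<open>c^2\<close>. The linear term has mean zero, so \<open>N (E - 1) = N c^2 E G\<close>;
  dominated convergence sends \<open>E G\<close> to \<open>- t^2 \<phi> / 2\<close>.\<close>

lemma char_score_tendsto:
  "(\<lambda>n. measure_pmf.expectation (skellam_pmf (l n)) (\<lambda>k. iexp (t * (c n * skellam_score (l n) k))) ^ N n)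
     \<longlonglongrightarrow> of_real (exp (- t\<^sup>2 / 2))"
proof (rule tendsto_power_exp[OF N])
  let ?s = "\<lambda>n. skellam_score (l n)"
  define w where "w n k = t * (c n * ?s n k)" for n k
  define G where "G n k = (iexp (w n k) - 1 - \<i> * of_real (w n k)) / of_real ((c n)\<^sup>2)" for n k
  define E where "E n = measure_pmf.expectation (skellam_pmf (l n)) (\<lambda>k. iexp (w n k))" for n
  have c0: "c n \<noteq> 0" for n using c_pos[of n] by simp
  have "(\<lambda>n. measure_pmf.expectation (skellam_pmf (l n)) (G n)) \<longlonglongrightarrow>
     measure_pmf.expectation (skellam_pmf x) (\<lambda>k. of_real (- (t\<^sup>2 / 2 * (skellam_score x k)\<^sup>2)))"
  proof (rule skellam_tendsto_expectation[OF l x])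
    fix k
    have s: "(\<lambda>n. ?s n k) \<longlonglongrightarrow> skellam_score x k"
      by (rule tendsto_skellam_score[OF l x])
    have "(\<lambda>n. G n k - of_real (- (t\<^sup>2 / 2 * (?s n k)\<^sup>2))) \<longlonglongrightarrow> 0"
    proof (rule Lim_null_comparison)
      show "\<forall>\<^sub>F n in sequentially. norm (G n k - of_real (- (t\<^sup>2 / 2 * (?s n k)\<^sup>2))) \<le> c n * \<bar>t * ?s n k\<bar> ^ 3 / 6"
      proof (rule always_eventually, rule allI)
        fix n
        \<comment> \<open>Subtracting the quadratic term leaves a third-order remainder; after
          division by \<open>c^2\<close> one factor c is left and drives it to 0.\<close>
        have "G n k - of_real (- (t\<^sup>2 / 2 * (?s n k)\<^sup>2)) =
           (iexp (w n k) - (\<Sum>j\<le>2. (\<i> * of_real (w n k)) ^ j / fact j)) / of_real ((c n)\<^sup>2)"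
          using c0[of n] by (simp add: G_def w_def numeral_2_eq_2 field_simps power_mult_distrib)
        then have "norm (G n k - of_real (- (t\<^sup>2 / 2 * (?s n k)\<^sup>2))) =
           norm (iexp (w n k) - (\<Sum>j\<le>2. (\<i> * of_real (w n k)) ^ j / fact j)) / (c n)\<^sup>2"
          by (simp add: norm_divide norm_power)
        also have "\<dots> \<le> \<bar>w n k\<bar> ^ Suc 2 / fact (Suc 2) / (c n)\<^sup>2"
          by (intro divide_right_mono iexp_approx1) auto
        also have "\<dots> = c n * \<bar>t * ?s n k\<bar> ^ 3 / 6"
          using c_pos[of n] by (simp add: w_def abs_mult power_mult_distrib fact_numeral power3_eq_cube power2_eq_square numeral_2_eq_2 field_simps)
        finally show "norm (G n k - of_real (- (t\<^sup>2 / 2 * (?s n k)\<^sup>2))) \<le> c n * \<bar>t * ?s n k\<bar> ^ 3 / 6" .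
      qed
      have "(\<lambda>n. c n * \<bar>t * ?s n k\<bar> ^ 3 / 6) \<longlonglongrightarrow> 0 * \<bar>t * skellam_score x k\<bar> ^ 3 / 6"
        by (intro tendsto_intros c s) simp
      then show "(\<lambda>n. c n * \<bar>t * ?s n k\<bar> ^ 3 / 6) \<longlonglongrightarrow> 0" by simp
    qed
    moreover have "(\<lambda>n. of_real (- (t\<^sup>2 / 2 * (?s n k)\<^sup>2)) :: complex) \<longlonglongrightarrow> of_real (- (t\<^sup>2 / 2 * (skellam_score x k)\<^sup>2))"
      by (intro tendsto_intros s) simp
    ultimately show "(\<lambda>n. G n k) \<longlonglongrightarrow> of_real (- (t\<^sup>2 / 2 * (skellam_score x k)\<^sup>2))"
      by (rule Lim_transform[rotated])
  next
    show "\<forall>\<^sub>F n in sequentially. \<forall>k. norm (G n k) \<le> t\<^sup>2 / 2 * (1 + 2 * x + 1 / (x / 2))\<^sup>2 * (1 + \<bar>real_of_int k\<bar>)\<^sup>2"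
      using eventually_l_near
    proof eventually_elim
      case (elim n)
      show ?case
      proof
        fix k
        \<comment> \<open>The first-order remainder estimate is quadratic in w, so
          \<open>c^2\<close> cancels and the bound is free of c.\<close>
        have "norm (G n k) = norm (iexp (w n k) - (\<Sum>j\<le>1. (\<i> * of_real (w n k)) ^ j / fact j)) / (c n)\<^sup>2"
          by (simp add: G_def norm_divide norm_power diff_diff_eq)
        also have "\<dots> \<le> \<bar>w n k\<bar> ^ Suc 1 / fact (Suc 1) / (c n)\<^sup>2"
          by (intro divide_right_mono iexp_approx1) auto
        also have "\<dots> = t\<^sup>2 / 2 * (?s n k)\<^sup>2"
          using c0[of n] by (simp add: w_def power2_eq_square field_simps)
        also have "\<dots> \<le> t\<^sup>2 / 2 * ((1 + 2 * x + 1 / (x / 2))\<^sup>2 * (1 + \<bar>real_of_int k\<bar>)\<^sup>2)"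
          using elim x by (intro mult_left_mono linear_growth_imp_quadratic(2) skellam_score_bound) auto
        finally show "norm (G n k) \<le> t\<^sup>2 / 2 * (1 + 2 * x + 1 / (x / 2))\<^sup>2 * (1 + \<bar>real_of_int k\<bar>)\<^sup>2"
          by (simp only: mult.assoc)
      qed
    qed
  qed
  also have "measure_pmf.expectation (skellam_pmf x) (\<lambda>k. of_real (- (t\<^sup>2 / 2 * (skellam_score x k)\<^sup>2))) = (of_real (- (t\<^sup>2 / 2 * \<phi>)) :: complex)"
    unfolding \<phi>_def by (subst integral_complex_of_real) simp
  finally have G: "(\<lambda>n. measure_pmf.expectation (skellam_pmf (l n)) (G n)) \<longlonglongrightarrow> of_real (- (t\<^sup>2 / 2 * \<phi>))" .
  have EG: "E n - 1 = of_real ((c n)\<^sup>2) * measure_pmf.expectation (skellam_pmf (l n)) (G n)" for n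
  proof -
    have i1: "integrable (measure_pmf (skellam_pmf (l n))) (\<lambda>k. iexp (w n k))"
      by (rule measure_pmf.integrable_const_bound[where B = 1]) auto
    have i2: "integrable (measure_pmf (skellam_pmf (l n))) (\<lambda>k. of_real (w n k) :: complex)"
      unfolding w_def by (intro integrable_of_real integrable_mult_right integrable_skellam_score l_pos)
    have e2: "measure_pmf.expectation (skellam_pmf (l n)) (\<lambda>k. of_real (w n k) :: complex) = 0"
      by (subst integral_complex_of_real) (simp add: w_def[abs_def] expectation_skellam_score l_pos)
    have "of_real ((c n)\<^sup>2) * measure_pmf.expectation (skellam_pmf (l n)) (G n) =
       measure_pmf.expectation (skellam_pmf (l n)) (\<lambda>k. iexp (w n k) - 1 - \<i> * of_real (w n k))"
      using c0[of n] unfolding G_def by simp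
    also have "\<dots> = E n - 1 - \<i> * measure_pmf.expectation (skellam_pmf (l n)) (\<lambda>k. of_real (w n k) :: complex)"
      unfolding E_def using i1 i2 by (simp del: integral_complex_of_real)
    finally show ?thesis unfolding e2 by simp
  qed
  have "(\<lambda>n. of_real (real (N n) * (c n)\<^sup>2) * measure_pmf.expectation (skellam_pmf (l n)) (G n)) \<longlonglongrightarrow>
     of_real (1 / \<phi>) * of_real (- (t\<^sup>2 / 2 * \<phi>))"
    by (intro tendsto_intros G Nc)
  also have "(\<lambda>n. of_real (real (N n) * (c n)\<^sup>2) * measure_pmf.expectation (skellam_pmf (l n)) (G n)) =
     (\<lambda>n. of_nat (N n) * (E n - 1))"
    by (simp add: EG mult_ac)
  also have "of_real (1 / \<phi>) * of_real (- (t\<^sup>2 / 2 * \<phi>)) = (of_real (- t\<^sup>2 / 2) :: complex)"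
    unfolding of_real_mult[symmetric] using \<phi>_pos by simp
  finally show "(\<lambda>n. of_nat (N n) * (measure_pmf.expectation (skellam_pmf (l n)) (\<lambda>k. iexp (t * (c n * skellam_score (l n) k))) - 1)) \<longlonglongrightarrow>
     complex_of_real (- t\<^sup>2 / 2)"
    by (simp add: E_def w_def)
next
  fix n
  have "norm (measure_pmf.expectation (skellam_pmf (l n)) (\<lambda>k. iexp (t * (c n * skellam_score (l n) k)))) \<le>
    measure_pmf.expectation (skellam_pmf (l n)) (\<lambda>k. norm (iexp (t * (c n * skellam_score (l n) k))))"
    by (rule integral_norm_bound)
  then show "norm (measure_pmf.expectation (skellam_pmf (l n)) (\<lambda>k. iexp (t * (c n * skellam_score (l n) k)))) \<le> 1"
    by simp
qed simp

lemma score_sum_CLT: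
  fixes g :: "real \<Rightarrow> real"
  assumes "continuous_on UNIV g" "bounded (range g)"
  shows "(\<lambda>n. measure_pmf.expectation (iid_pmf (N n) (skellam_pmf (l n)))
     (\<lambda>ks. g (\<Sum>k\<leftarrow>ks. c n * skellam_score (l n) k))) \<longlonglongrightarrow> integral\<^sup>L std_normal_distribution g"
proof -
  define S where "S n ks = (\<Sum>k\<leftarrow>ks. c n * skellam_score (l n) k)" for n ks
  define M where "M n = distr (measure_pmf (iid_pmf (N n) (skellam_pmf (l n)))) borel (S n)" for n
  have rd: "real_distribution (M n)" for n
    unfolding M_def by (intro prob_space.real_distribution_distr measure_pmf.prob_space_axioms) simp
  have rn: "real_distribution std_normal_distribution"
    by (rule real_dist_normal_dist)
  have "weak_conv_m M std_normal_distribution"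
  proof (rule levy_continuity[OF rd rn])
    fix t
    show "(\<lambda>n. char (M n) t) \<longlonglongrightarrow> char std_normal_distribution t"
      using char_score_tendsto[of t] by (simp add: M_def S_def[abs_def] char_iid_sum char_std_normal_distribution)
  qed
  moreover obtain B where "\<And>x. norm (g x) \<le> B"
    using assms(2) by (auto simp: bounded_iff)
  moreover have "isCont g x" for x
    using assms(1) by (simp add: continuous_on_eq_continuous_at)
  ultimately have "(\<lambda>n. integral\<^sup>L (M n) g) \<longlonglongrightarrow> integral\<^sup>L std_normal_distribution g"
    by (intro weak_conv_imp_integral_bdd_continuous_conv[OF rd rn])
  moreover have "g \<in> borel_measurable borel"
    by (rule borel_measurable_continuous_onI[OF assms(1)])
  ultimately show ?thesis
    by (simp add: M_def integral_distr S_def)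
qed

text \<open>By Taylor, \<open>Z\<close> is \<open>(v c)^2 / 2\<close> times the score derivative at
  a nearby point. As \<open>E s' = - \<phi>\<close>, \<open>N E Z\<close> tends to
  \<open>- v^2 / 2\<close>, while \<open>N E Z^2\<close> is of order \<open>N c^4\<close> and
  vanishes; Chebyshev's inequality concludes.\<close>

lemma log_ratio_remainder_tendsto:
  fixes v e :: real
  assumes "e > 0"
  defines "Z \<equiv> \<lambda>n k. ln (pmf (skellam_pmf (l n + v * c n)) k / pmf (skellam_pmf (l n)) k) - v * c n * skellam_score (l n) k"
  shows "(\<lambda>n. measure_pmf.prob (iid_pmf (N n) (skellam_pmf (l n)))
     {ks. \<bar>(\<Sum>k\<leftarrow>ks. Z n k) + v\<^sup>2 / 2\<bar> > e}) \<longlonglongrightarrow> 0"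
proof -
  have c0: "c n \<noteq> 0" for n using c_pos[of n] by simp
  have lv: "(\<lambda>n. l n + v * c n) \<longlonglongrightarrow> x"
    using tendsto_add[OF l tendsto_mult[OF tendsto_const[of v] c]] by simp
  \<comment> \<open>These margins keep every intermediate point between \<open>x / 2\<close> and
    \<open>2 * x\<close>.\<close>
  have ev: "\<forall>\<^sub>F n in sequentially. \<bar>v * c n\<bar> < x / 4 \<and> 3 * x / 4 < l n \<and> l n < 3 * x / 2 \<and> l n + v * c n > 0"
  proof -
    have "(\<lambda>n. \<bar>v * c n\<bar>) \<longlonglongrightarrow> 0"
      using tendsto_rabs[OF tendsto_mult[OF tendsto_const[of v] c]] by simp
    from order_tendstoD(2)[OF this, of "x / 4"] order_tendstoD(1)[OF l, of "3 * x / 4"] order_tendstoD(2)[OF l, of "3 * x / 2"] order_tendstoD(1)[OF lv, of 0] x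
    show ?thesis by (simp add: eventually_conj_iff)
  qed
  have "\<exists>y. \<forall>n k. l n + v * c n > 0 \<longrightarrow> \<bar>y n k - l n\<bar> \<le> \<bar>v * c n\<bar> \<and>
     Z n k = skellam_score_deriv (y n k) k * (v * c n)\<^sup>2 / 2"
    unfolding Z_def using skellam_log_ratio_Taylor[OF l_pos] by (intro choice allI) metis
  then obtain y where y: "\<And>n k. l n + v * c n > 0 \<Longrightarrow> \<bar>y n k - l n\<bar> \<le> \<bar>v * c n\<bar>"
     "\<And>n k. l n + v * c n > 0 \<Longrightarrow> Z n k = skellam_score_deriv (y n k) k * (v * c n)\<^sup>2 / 2" by blast
  \<comment> \<open>Division by \<open>c^2\<close> gives the sequence a nontrivial limit; C below is
    \<open>v^2 / 2\<close> times the constant of \<open>skellam_score_deriv_bound\<close> on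
    \<open>[x/2, 2x]\<close>.\<close>
  define Y where "Y n k = Z n k / (c n)\<^sup>2" for n k
  define C where "C = v\<^sup>2 / 2 * (2 * x * (2 * (2 * x) + 1 / (x / 2)) + 1 / (x / 2)\<^sup>2)"
  have Y_lim: "(\<lambda>n. Y n k) \<longlonglongrightarrow> v\<^sup>2 / 2 * skellam_score_deriv x k" for k
  proof -
    have "(\<lambda>n. y n k - l n) \<longlonglongrightarrow> 0"
    proof (rule Lim_null_comparison)
      show "\<forall>\<^sub>F n in sequentially. norm (y n k - l n) \<le> \<bar>v * c n\<bar>"
        using ev by eventually_elim (use y in auto)
      show "(\<lambda>n. \<bar>v * c n\<bar>) \<longlonglongrightarrow> 0"
        using tendsto_rabs[OF tendsto_mult[OF tendsto_const[of v] c]] by simp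
    qed
    from tendsto_add[OF this l] have "(\<lambda>n. y n k) \<longlonglongrightarrow> x" by simp
    then have "(\<lambda>n. v\<^sup>2 / 2 * skellam_score_deriv (y n k) k) \<longlonglongrightarrow> v\<^sup>2 / 2 * skellam_score_deriv x k"
      by (intro tendsto_intros tendsto_skellam_score_deriv x)
    moreover have "\<forall>\<^sub>F n in sequentially. v\<^sup>2 / 2 * skellam_score_deriv (y n k) k = Y n k"
      using ev by eventually_elim (use y c0 in \<open>simp add: Y_def field_simps power_mult_distrib\<close>)
    ultimately show ?thesis by (rule Lim_transform_eventually)
  qed
  have Y_bound: "\<forall>\<^sub>F n in sequentially. \<forall>k. \<bar>Y n k\<bar> \<le> C * (1 + \<bar>real_of_int k\<bar>)"
    using ev
  proof eventually_elim
    case (elim n)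
    show ?case
    proof
      fix k
      have near: "x / 2 \<le> y n k" "y n k \<le> 2 * x"
        using y(1)[of n k] elim by linarith+
      have "Y n k = v\<^sup>2 / 2 * skellam_score_deriv (y n k) k"
        using elim y(2)[of n k] c0[of n] by (simp add: Y_def power_mult_distrib)
      then have "\<bar>Y n k\<bar> = v\<^sup>2 / 2 * \<bar>skellam_score_deriv (y n k) k\<bar>"
        by (simp only: abs_mult abs_power2 abs_divide abs_numeral)
      also have "\<dots> \<le> v\<^sup>2 / 2 * ((2 * x * (2 * (2 * x) + 1 / (x / 2)) + 1 / (x / 2)\<^sup>2) * (1 + \<bar>real_of_int k\<bar>))"
        using near x by (intro mult_left_mono skellam_score_deriv_bound) auto
      finally show "\<bar>Y n k\<bar> \<le> C * (1 + \<bar>real_of_int k\<bar>)"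
        by (simp only: C_def mult.assoc)
    qed
  qed
  have EY: "(\<lambda>n. measure_pmf.expectation (skellam_pmf (l n)) (Y n)) \<longlonglongrightarrow> v\<^sup>2 / 2 * (- \<phi>)"
  proof -
    have "(\<lambda>n. measure_pmf.expectation (skellam_pmf (l n)) (Y n)) \<longlonglongrightarrow>
      measure_pmf.expectation (skellam_pmf x) (\<lambda>k. v\<^sup>2 / 2 * skellam_score_deriv x k)"
      by (rule skellam_tendsto_expectation[OF l x Y_lim, where C = C])
         (use Y_bound in eventually_elim, simp add: linear_growth_imp_quadratic(1))
    then show ?thesis
      by (simp add: expectation_skellam_score_deriv[OF x] \<phi>_def)
  qed
  define K where "K = measure_pmf.expectation (skellam_pmf x) (\<lambda>k. (v\<^sup>2 / 2 * skellam_score_deriv x k)\<^sup>2)"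
  have EY2: "(\<lambda>n. measure_pmf.expectation (skellam_pmf (l n)) (\<lambda>k. (Y n k)\<^sup>2)) \<longlonglongrightarrow> K"
    unfolding K_def
    by (rule skellam_tendsto_expectation[OF l x tendsto_power[OF Y_lim], where C = "C\<^sup>2"])
       (use Y_bound in eventually_elim, simp add: linear_growth_imp_quadratic(2))
  define R where "R n = (real (N n) * measure_pmf.expectation (skellam_pmf (l n)) (\<lambda>k. (Z n k)\<^sup>2) +
      (real (N n) * measure_pmf.expectation (skellam_pmf (l n)) (Z n) + v\<^sup>2 / 2)\<^sup>2) / e\<^sup>2" for n
  have ZY: "Z n k = (c n)\<^sup>2 * Y n k" for n k
    using c0[of n] by (simp add: Y_def)
  have R: "R n = (real (N n) * (c n)\<^sup>2 * (c n)\<^sup>2 * measure_pmf.expectation (skellam_pmf (l n)) (\<lambda>k. (Y n k)\<^sup>2) +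
      (real (N n) * (c n)\<^sup>2 * measure_pmf.expectation (skellam_pmf (l n)) (Y n) + v\<^sup>2 / 2)\<^sup>2) / e\<^sup>2" for n
    unfolding R_def ZY[abs_def] power_mult_distrib by (simp add: mult_ac power2_eq_square)
  \<comment> \<open>The second-moment part carries a spare \<open>c^2\<close>, and in the mean part
    \<open>1/\<phi>\<close> times \<open>- \<phi> v^2 / 2\<close> cancels
    \<open>v^2 / 2\<close>.\<close>
  have "R \<longlonglongrightarrow> (1 / \<phi> * 0\<^sup>2 * K + (1 / \<phi> * (v\<^sup>2 / 2 * (- \<phi>)) + v\<^sup>2 / 2)\<^sup>2) / e\<^sup>2"
    unfolding R[abs_def] by (intro tendsto_intros Nc c EY EY2) (use \<open>e > 0\<close> in auto)
  then have "R \<longlonglongrightarrow> 0" using \<phi>_pos by simp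
  moreover have "\<forall>\<^sub>F n in sequentially. norm (measure_pmf.prob (iid_pmf (N n) (skellam_pmf (l n)))
     {ks. \<bar>(\<Sum>k\<leftarrow>ks. Z n k) + v\<^sup>2 / 2\<bar> > e}) \<le> R n"
    using Y_bound
  proof eventually_elim
    case (elim n)
    have "integrable (measure_pmf (skellam_pmf (l n))) (\<lambda>k. (Y n k)\<^sup>2)"
      by (rule integrable_skellam[OF l_pos, where C = "C\<^sup>2"])
         (use elim in \<open>simp add: linear_growth_imp_quadratic(2)\<close>)
    then have "integrable (measure_pmf (skellam_pmf (l n))) (\<lambda>k. (Z n k)\<^sup>2)"
      unfolding ZY power_mult_distrib by simp
    from iid_sum_Chebyshev[OF this \<open>e > 0\<close>] show ?case
      by (simp add: R_def)
  qed
  ultimately show ?thesis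
    by (rule Lim_null_comparison[rotated])
qed

end

section \<open>The sampled random walk\<close>

text \<open>Reduces limits in T to sequences of positive times, for which \<Delta> is known to be
  positive, by discarding finitely many terms.\<close>

lemma tendsto_at_topI_pos_sequentially:
  fixes f :: "real \<Rightarrow> 'b::first_countable_topology"
  assumes "\<And>X. filterlim X at_top sequentially \<Longrightarrow> (\<And>n. X n > 0) \<Longrightarrow> (\<lambda>n. f (X n)) \<longlonglongrightarrow> y"
  shows "(f \<longlongrightarrow> y) at_top"
proof (rule tendsto_at_topI_sequentially)
  fix X :: "nat \<Rightarrow> real" assume X: "filterlim X at_top sequentially"
  then have "\<forall>\<^sub>F n in sequentially. X n > 0" by (simp add: filterlim_at_top_dense)
  then obtain m where m: "\<And>n. n \<ge> m \<Longrightarrow> X n > 0" unfolding eventually_sequentially by blast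
  have "filterlim (\<lambda>n. X (n + m)) at_top sequentially"
    by (rule filterlim_compose[OF X filterlim_add_const_nat_at_top])
  then have "(\<lambda>n. f (X (n + m))) \<longlonglongrightarrow> y"
    using m by (intro assms) auto
  then show "(\<lambda>n. f (X n)) \<longlonglongrightarrow> y" by (rule LIMSEQ_offset)
qed

lemma tendsto_nat_floor_ratio:
  assumes "filterlim y at_top F"
  shows "((\<lambda>n. real (nat \<lfloor>y n\<rfloor>) / y n) \<longlongrightarrow> (1 :: real)) F"
proof (rule tendsto_sandwich)
  have "\<forall>\<^sub>F n in F. y n \<ge> 1" using assms by (simp add: filterlim_at_top)
  then show "\<forall>\<^sub>F n in F. 1 - 1 / y n \<le> real (nat \<lfloor>y n\<rfloor>) / y n"
  proof eventually_elim
    case (elim n)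
    then have "(y n - 1) / y n \<le> real (nat \<lfloor>y n\<rfloor>) / y n"
      by (intro divide_right_mono) linarith+
    with elim show ?case by (simp add: diff_divide_distrib)
  qed
  show "\<forall>\<^sub>F n in F. real (nat \<lfloor>y n\<rfloor>) / y n \<le> 1"
    using \<open>\<forall>\<^sub>F n in F. y n \<ge> 1\<close> by eventually_elim (simp add: field_simps)
  have "((\<lambda>n. 1 / y n) \<longlongrightarrow> 0) F"
    by (rule tendsto_divide_0[OF tendsto_const filterlim_at_top_imp_at_infinity[OF assms]])
  from tendsto_diff[OF tendsto_const this] show "((\<lambda>n. 1 - 1 / y n) \<longlongrightarrow> 1) F" by simp
qed simp

lemma filterlim_nat_floor_at_top:
  assumes "filterlim y at_top F"
  shows "filterlim (\<lambda>n. nat \<lfloor>y n :: real\<rfloor>) at_top F"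
  unfolding filterlim_at_top
proof
  fix Z :: nat
  have "\<forall>\<^sub>F n in F. y n \<ge> real Z" using assms by (simp add: filterlim_at_top)
  then show "\<forall>\<^sub>F n in F. Z \<le> nat \<lfloor>y n\<rfloor>" by eventually_elim (rule le_nat_floor)
qed

text \<open>Differences of consecutive partial sums recover the increments, so path and increments
  carry the same likelihood.\<close>

lemma inj_psums: "inj psums"
proof (rule injI)
  fix xs ys :: "int list" assume eq: "psums xs = psums ys"
  then have "length (psums xs) = length (psums ys)" by simp
  then have len: "length xs = length ys" by (simp add: psums_def)
  have st: "sum_list (take j xs) = sum_list (take j ys)" if "j \<le> length xs" for j
  proof -
    have "psums xs ! j = psums ys ! j" using eq by simp
    then show ?thesis using that len by (simp add: psums_def del: upt_Suc)
  qed
  show "xs = ys"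
  proof (rule nth_equalityI[OF len])
    fix i assume "i < length xs"
    then show "xs ! i = ys ! i"
      using st[of i] st[of "Suc i"] len by (simp add: take_Suc_conv_app_nth)
  qed
qed

text \<open>Thus \<open>phi\<close> is the Fisher information about x in one increment. About
  \<theta> it is \<open>\<Delta>^2 phi\<close>, and some \<open>T / \<Delta>\<close> increments
  produce the normalisation \<open>T * \<Delta> * phi\<close>.\<close>

lemma phi_eq_skellam:
  "phi \<theta> \<Delta> = measure_pmf.expectation (skellam_pmf (\<theta> * \<Delta>)) (\<lambda>k. (skellam_score (\<theta> * \<Delta>) k)\<^sup>2)"
  by (simp add: phi_def h_fun_def skellam_score_def bessel_ratio_def incr_pmf_eq_skellam)

lemma phi_pos: "\<theta> * \<Delta> > 0 \<Longrightarrow> phi \<theta> \<Delta> > 0"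
  unfolding phi_eq_skellam by (rule expectation_skellam_score_square_pos)

lemma tendsto_phi:
  assumes D: "D \<longlonglongrightarrow> \<Delta>" and pos: "\<theta> * \<Delta> > 0"
  shows "(\<lambda>n. phi \<theta> (D n)) \<longlonglongrightarrow> phi \<theta> \<Delta>"
proof -
  have l: "(\<lambda>n. \<theta> * D n) \<longlonglongrightarrow> \<theta> * \<Delta>" by (intro tendsto_intros D)
  have "\<forall>\<^sub>F n in sequentially. \<theta> * \<Delta> / 2 < \<theta> * D n \<and> \<theta> * D n < 2 * (\<theta> * \<Delta>)"
    by (intro eventually_conj order_tendstoD[OF l]) (use pos in linarith)+
  then have "\<forall>\<^sub>F n in sequentially. \<forall>k. norm ((skellam_score (\<theta> * D n) k)\<^sup>2) \<le>
    (1 + 2 * (\<theta> * \<Delta>) + 1 / (\<theta> * \<Delta> / 2))\<^sup>2 * (1 + \<bar>real_of_int k\<bar>)\<^sup>2"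
  proof eventually_elim
    case (elim n)
    have "0 < \<theta> * \<Delta> / 2" using pos by linarith
    from linear_growth_imp_quadratic(2)[OF skellam_score_bound[OF this]] elim
    show ?case unfolding real_norm_def abs_power2 by (meson less_imp_le)
  qed
  then show ?thesis
    unfolding phi_eq_skellam
    by (intro skellam_tendsto_expectation[OF l pos] tendsto_power tendsto_skellam_score[OF l pos])
qed

lemma obs_pmf_eq: "obs_pmf T D \<theta> = map_pmf psums (iid_pmf (nat \<lfloor>T / D\<rfloor>) (skellam_pmf (\<theta> * D)))"
  by (simp add: obs_pmf_def incr_pmf_eq_skellam)

lemma obs_likelihood_ratio:
  assumes "\<theta> * D > 0" "\<theta>' * D > 0" and ks: "length ks = nat \<lfloor>T / D\<rfloor>"
  defines "q \<equiv> pmf (obs_pmf T D \<theta>') (psums ks) / pmf (obs_pmf T D \<theta>) (psums ks)"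
  shows "q > 0"
    and "ln q = (\<Sum>k\<leftarrow>ks. ln (pmf (skellam_pmf (\<theta>' * D)) k / pmf (skellam_pmf (\<theta> * D)) k))"
proof -
  have q: "q = (\<Prod>k\<leftarrow>ks. pmf (skellam_pmf (\<theta>' * D)) k) / (\<Prod>k\<leftarrow>ks. pmf (skellam_pmf (\<theta> * D)) k)"
    unfolding q_def obs_pmf_eq pmf_map_inj'[OF inj_psums] pmf_iid_pmf using ks by simp
  have "(\<Prod>k\<leftarrow>ks. pmf (skellam_pmf (\<theta>' * D)) k) / (\<Prod>k\<leftarrow>ks. pmf (skellam_pmf (\<theta> * D)) k) > 0 \<and>
    ln ((\<Prod>k\<leftarrow>ks. pmf (skellam_pmf (\<theta>' * D)) k) / (\<Prod>k\<leftarrow>ks. pmf (skellam_pmf (\<theta> * D)) k)) =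
      (\<Sum>k\<leftarrow>ks. ln (pmf (skellam_pmf (\<theta>' * D)) k / pmf (skellam_pmf (\<theta> * D)) k))" for ks :: "int list"
  proof (induction ks)
    case (Cons k ks)
    have "pmf (skellam_pmf (\<theta>' * D)) k / pmf (skellam_pmf (\<theta> * D)) k > 0"
      using pmf_skellam_pos assms by simp
    from ln_mult_pos[OF this Cons.IH[THEN conjunct1]] mult_pos_pos[OF this Cons.IH[THEN conjunct1]] Cons.IH
    show ?case by simp
  qed simp
  then show "q > 0" "ln q = (\<Sum>k\<leftarrow>ks. ln (pmf (skellam_pmf (\<theta>' * D)) k / pmf (skellam_pmf (\<theta> * D)) k))"
    unfolding q by blast+
qed

text \<open>A step \<open>v / sqrt I\<close> in \<theta> is the step
  \<open>v * \<Delta> / sqrt I\<close> in \<open>x = \<theta> * \<Delta>\<close>, which dictates the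
  choice of c.\<close>

lemma skellam_array_sampling:
  fixes \<Delta> :: "real \<Rightarrow> real" and X :: "nat \<Rightarrow> real"
  assumes "\<theta> > 0" and \<Delta>: "\<forall>T>0. \<Delta> T > 0" "(\<Delta> \<longlongrightarrow> d) at_top" "d > 0"
    and X: "filterlim X at_top sequentially" "\<And>n. X n > 0"
  shows "skellam_array (\<lambda>n. \<theta> * \<Delta> (X n)) (\<lambda>n. \<Delta> (X n) / sqrt (X n * d * phi \<theta> d))
    (\<lambda>n. nat \<lfloor>X n / \<Delta> (X n)\<rfloor>) (\<theta> * d) (phi \<theta> d)"
proof
  have phi: "phi \<theta> d > 0" using assms by (intro phi_pos) simp
  have D: "(\<lambda>n. \<Delta> (X n)) \<longlonglongrightarrow> d" by (rule filterlim_compose[OF \<Delta>(2) X(1)])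
  have Dpos: "\<Delta> (X n) > 0" for n using \<Delta> X by simp
  show "\<theta> * d > 0" using assms by simp
  show "(\<lambda>n. \<theta> * \<Delta> (X n)) \<longlonglongrightarrow> \<theta> * d" by (intro tendsto_intros D)
  show "\<theta> * \<Delta> (X n) > 0" "\<Delta> (X n) / sqrt (X n * d * phi \<theta> d) > 0" for n
    using Dpos[of n] X(2)[of n] phi assms by auto
  have "filterlim (\<lambda>n. d * phi \<theta> d * X n) at_top sequentially"
    using phi \<open>d > 0\<close> by (intro filterlim_tendsto_pos_mult_at_top[OF tendsto_const _ X(1)]) simp
  from filterlim_compose[OF sqrt_at_top this]
  have "filterlim (\<lambda>n. sqrt (X n * d * phi \<theta> d)) at_top sequentially" by (simp add: mult_ac)
  then show "(\<lambda>n. \<Delta> (X n) / sqrt (X n * d * phi \<theta> d)) \<longlonglongrightarrow> 0"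
    by (intro tendsto_divide_0[OF D] filterlim_at_top_imp_at_infinity)
  show "phi \<theta> d = measure_pmf.expectation (skellam_pmf (\<theta> * d)) (\<lambda>k. (skellam_score (\<theta> * d) k)\<^sup>2)"
    by (rule phi_eq_skellam)
  have "(\<lambda>n. 1 / \<Delta> (X n)) \<longlonglongrightarrow> 1 / d" using \<open>d > 0\<close> by (intro tendsto_intros D) simp
  from filterlim_tendsto_pos_mult_at_top[OF this _ X(1)] \<open>d > 0\<close>
  have Y: "filterlim (\<lambda>n. X n / \<Delta> (X n)) at_top sequentially" by simp
  then show "filterlim (\<lambda>n. nat \<lfloor>X n / \<Delta> (X n)\<rfloor>) at_top sequentially"
    by (rule filterlim_nat_floor_at_top)
  \<comment> \<open>Splits \<open>N c^2\<close> into the rounding quotient, which tends to 1, and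
    \<open>\<Delta> / (d * phi)\<close>, which tends to \<open>1 / phi\<close>.\<close>
  have "(\<lambda>n. real (nat \<lfloor>X n / \<Delta> (X n)\<rfloor>) / (X n / \<Delta> (X n)) * (\<Delta> (X n) / (d * phi \<theta> d))) \<longlonglongrightarrow> 1 * (d / (d * phi \<theta> d))"
    using phi \<open>d > 0\<close> by (intro tendsto_mult tendsto_nat_floor_ratio[OF Y] tendsto_divide D tendsto_const) simp
  also have "1 * (d / (d * phi \<theta> d)) = 1 / phi \<theta> d" using \<open>d > 0\<close> by simp
  also have "(\<lambda>n. real (nat \<lfloor>X n / \<Delta> (X n)\<rfloor>) / (X n / \<Delta> (X n)) * (\<Delta> (X n) / (d * phi \<theta> d))) =
     (\<lambda>n. real (nat \<lfloor>X n / \<Delta> (X n)\<rfloor>) * (\<Delta> (X n) / sqrt (X n * d * phi \<theta> d))\<^sup>2)"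
    using phi \<open>d > 0\<close> X(2) by (simp add: power_divide less_imp_le power2_eq_square mult_ac)
  finally show "(\<lambda>n. real (nat \<lfloor>X n / \<Delta> (X n)\<rfloor>) * (\<Delta> (X n) / sqrt (X n * d * phi \<theta> d))\<^sup>2) \<longlonglongrightarrow> 1 / phi \<theta> d" .
qed

theorem theorem1:
  fixes \<Theta> :: "real set" and \<Delta> :: "real \<Rightarrow> real" and \<Delta>\<^sub>i\<^sub>n\<^sub>f :: real and \<theta> :: real
  assumes "open \<Theta>" and "\<Theta> \<subseteq> {0<..}"
    and "\<forall>T>0. \<Delta> T > 0"
    and "(\<Delta> \<longlongrightarrow> \<Delta>\<^sub>i\<^sub>n\<^sub>f) at_top" and "\<Delta>\<^sub>i\<^sub>n\<^sub>f > 0"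
    and "\<theta> \<in> \<Theta>"
  shows "LAN (\<lambda>T. obs_pmf T (\<Delta> T)) \<Theta> \<theta> (\<lambda>T. T * \<Delta>\<^sub>i\<^sub>n\<^sub>f * phi \<theta> \<Delta>\<^sub>i\<^sub>n\<^sub>f)
         \<and> ((\<lambda>T. (T * \<Delta> T * phi \<theta> (\<Delta> T)) / (T * \<Delta>\<^sub>i\<^sub>n\<^sub>f * phi \<theta> \<Delta>\<^sub>i\<^sub>n\<^sub>f)) \<longlongrightarrow> 1) at_top"
proof
  define d where "d = \<Delta>\<^sub>i\<^sub>n\<^sub>f"
  define I where "I T = T * d * phi \<theta> d" for T
  have d: "d > 0" and \<Delta>: "(\<Delta> \<longlongrightarrow> d) at_top" using assms by (simp_all add: d_def)
  have \<theta>: "\<theta> > 0" using assms by auto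
  have phi: "phi \<theta> d > 0" using \<theta> d by (intro phi_pos) simp
  have I_pos: "I T > 0" if "T > 0" for T using that d phi by (simp add: I_def)
  note array = skellam_array_sampling[OF \<theta> assms(3) \<Delta> d, folded I_def]
  \<comment> \<open>The central sequence is the normalised score of the increments, recovered from
    the path by inverting \<open>psums\<close>.\<close>
  define \<xi> where "\<xi> T \<omega> = (\<Sum>k\<leftarrow>inv psums \<omega>. \<Delta> T / sqrt (I T) * skellam_score (\<theta> * \<Delta> T) k)" for T \<omega>
  define q where "q v T \<omega> = pmf (obs_pmf T (\<Delta> T) (\<theta> + v / sqrt (I T))) \<omega> / pmf (obs_pmf T (\<Delta> T) \<theta>) \<omega>" for v T \<omega>
  \<comment> \<open>The remainder is whatever makes the expansion exact. Outside \<Theta>, where no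
    expansion is demanded, the value 0 keeps it from disturbing convergence in probability.\<close>
  define r where "r v T \<omega> = (if \<theta> + v / sqrt (I T) \<in> \<Theta> then ln (q v T \<omega>) - v * \<xi> T \<omega> + v\<^sup>2 / 2 else 0)" for v T \<omega>
  have \<xi>_psums: "\<xi> T (psums ks) = (\<Sum>k\<leftarrow>ks. \<Delta> T / sqrt (I T) * skellam_score (\<theta> * \<Delta> T) k)" for T ks
    by (simp add: \<xi>_def inv_f_f[OF inj_psums])
  have conv: "conv_distr_std_normal (\<lambda>T. obs_pmf T (\<Delta> T) \<theta>) \<xi>"
    unfolding conv_distr_std_normal_def
  proof (intro allI impI tendsto_at_topI_pos_sequentially)
    fix g :: "real \<Rightarrow> real" and X :: "nat \<Rightarrow> real"
    assume g: "continuous_on UNIV g \<and> bounded (range g)"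
      and X: "filterlim X at_top sequentially" "\<And>n. X n > 0"
    interpret skellam_array "\<lambda>n. \<theta> * \<Delta> (X n)" "\<lambda>n. \<Delta> (X n) / sqrt (I (X n))"
      "\<lambda>n. nat \<lfloor>X n / \<Delta> (X n)\<rfloor>" "\<theta> * d" "phi \<theta> d"
      by (rule array[OF X])
    from score_sum_CLT[of g] g
    show "(\<lambda>n. measure_pmf.expectation (obs_pmf (X n) (\<Delta> (X n)) \<theta>) (\<lambda>\<omega>. g (\<xi> (X n) \<omega>)))
      \<longlonglongrightarrow> integral\<^sup>L std_normal_distribution g"
      by (simp add: obs_pmf_eq \<xi>_psums)
  qed
  have ratio: "q v T \<omega> = exp (v * \<xi> T \<omega> - v\<^sup>2 / 2 + r v T \<omega>)"
    if T: "T > 0" and \<Theta>: "\<theta> + v / sqrt (I T) \<in> \<Theta>" and \<omega>: "\<omega> \<in> set_pmf (obs_pmf T (\<Delta> T) \<theta>)" for v T \<omega>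
  proof -
    obtain ks where ks: "\<omega> = psums ks" "length ks = nat \<lfloor>T / \<Delta> T\<rfloor>"
      using \<omega> by (auto simp: obs_pmf_eq set_pmf_iid_pmf)
    have "\<Delta> T > 0" using assms T by simp
    moreover have "\<theta> + v / sqrt (I T) > 0" using assms \<Theta> by auto
    ultimately have "q v T \<omega> > 0"
      unfolding q_def ks(1) using \<theta> ks(2) by (intro obs_likelihood_ratio(1)) auto
    then show ?thesis
      using \<Theta> by (simp add: r_def)
  qed
  have remainder: "conv_prob_zero (\<lambda>T. obs_pmf T (\<Delta> T) \<theta>) (r v)" for v
    unfolding conv_prob_zero_def
  proof (intro allI impI tendsto_at_topI_pos_sequentially)
    fix e :: real and X :: "nat \<Rightarrow> real"
    assume e: "e > 0" and X: "filterlim X at_top sequentially" "\<And>n. X n > 0"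
    interpret skellam_array "\<lambda>n. \<theta> * \<Delta> (X n)" "\<lambda>n. \<Delta> (X n) / sqrt (I (X n))"
      "\<lambda>n. nat \<lfloor>X n / \<Delta> (X n)\<rfloor>" "\<theta> * d" "phi \<theta> d"
      by (rule array[OF X])
    show "(\<lambda>n. measure_pmf.prob (obs_pmf (X n) (\<Delta> (X n)) \<theta>) {\<omega>. e < \<bar>r v (X n) \<omega>\<bar>}) \<longlonglongrightarrow> 0"
    proof (rule Lim_null_comparison[OF always_eventually log_ratio_remainder_tendsto[OF e, of v]], rule allI)
      fix n
      let ?T = "X n" and ?D = "\<Delta> (X n)"
      let ?iid = "iid_pmf (nat \<lfloor>?T / ?D\<rfloor>) (skellam_pmf (\<theta> * ?D))"
      let ?c = "?D / sqrt (I ?T)"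
      let ?Z = "\<lambda>k. ln (pmf (skellam_pmf (\<theta> * ?D + v * ?c)) k / pmf (skellam_pmf (\<theta> * ?D)) k) - v * ?c * skellam_score (\<theta> * ?D) k"
      \<comment> \<open>A remainder above e is nonzero, so the shifted parameter lies in \<Theta>
        and r coincides with the remainder of the Skellam array; the event is thus contained in the
        one already controlled.\<close>
      have "measure_pmf.prob ?iid {ks. e < \<bar>r v ?T (psums ks)\<bar>} \<le> measure_pmf.prob ?iid {ks. e < \<bar>(\<Sum>k\<leftarrow>ks. ?Z k) + v\<^sup>2 / 2\<bar>}"
      proof (rule measure_pmf.finite_measure_mono_AE, rule AE_pmfI, rule impI)
        fix ks assume "ks \<in> set_pmf ?iid" and ks: "ks \<in> {ks. e < \<bar>r v ?T (psums ks)\<bar>}"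
        then have len: "length ks = nat \<lfloor>?T / ?D\<rfloor>" by (simp add: set_pmf_iid_pmf)
        have \<Theta>: "\<theta> + v / sqrt (I ?T) \<in> \<Theta>"
          using ks e by (auto simp: r_def split: if_splits)
        have "\<theta> * ?D + v * ?c = (\<theta> + v / sqrt (I ?T)) * ?D" by (simp add: algebra_simps)
        moreover have "ln (q v ?T (psums ks)) = (\<Sum>k\<leftarrow>ks. ln (pmf (skellam_pmf ((\<theta> + v / sqrt (I ?T)) * ?D)) k / pmf (skellam_pmf (\<theta> * ?D)) k))"
        proof -
          have "?D > 0" "\<theta> + v / sqrt (I ?T) > 0" using assms X(2) \<Theta> by auto
          then show ?thesis
            unfolding q_def using \<theta> len by (intro obs_likelihood_ratio(2)) auto
        qed
        moreover have "v * \<xi> ?T (psums ks) = (\<Sum>k\<leftarrow>ks. v * ?c * skellam_score (\<theta> * ?D) k)"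
          unfolding \<xi>_psums mult.assoc by (rule sum_list_const_mult[symmetric])
        ultimately have "r v ?T (psums ks) = (\<Sum>k\<leftarrow>ks. ?Z k) + v\<^sup>2 / 2"
          using \<Theta> by (simp add: r_def sum_list_subtractf)
        then show "ks \<in> {ks. e < \<bar>(\<Sum>k\<leftarrow>ks. ?Z k) + v\<^sup>2 / 2\<bar>}"
          using ks by simp
      qed simp
      then show "norm (measure_pmf.prob (obs_pmf ?T ?D \<theta>) {\<omega>. e < \<bar>r v ?T \<omega>\<bar>}) \<le>
         measure_pmf.prob ?iid {ks. e < \<bar>(\<Sum>k\<leftarrow>ks. ?Z k) + v\<^sup>2 / 2\<bar>}"
        by (simp add: obs_pmf_eq vimage_def)
    qed
  qed
  show "LAN (\<lambda>T. obs_pmf T (\<Delta> T)) \<Theta> \<theta> (\<lambda>T. T * \<Delta>\<^sub>i\<^sub>n\<^sub>f * phi \<theta> \<Delta>\<^sub>i\<^sub>n\<^sub>f)"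
    unfolding LAN_def d_def[symmetric] I_def[symmetric] q_def[symmetric]
    using I_pos conv ratio remainder by blast
  have "((\<lambda>T. (T * \<Delta> T * phi \<theta> (\<Delta> T)) / (T * d * phi \<theta> d)) \<longlongrightarrow> 1) at_top"
  proof (rule tendsto_at_topI_pos_sequentially)
    fix X :: "nat \<Rightarrow> real"
    assume X: "filterlim X at_top sequentially" "\<And>n. X n > 0"
    have D: "(\<lambda>n. \<Delta> (X n)) \<longlonglongrightarrow> d" by (rule filterlim_compose[OF \<Delta> X(1)])
    \<comment> \<open>The factor T cancels from the ratio, so continuity of \<open>phi\<close> in
      \<Delta> decides the limit.\<close>
    have "(\<lambda>n. (\<Delta> (X n) * phi \<theta> (\<Delta> (X n))) / (d * phi \<theta> d)) \<longlonglongrightarrow> (d * phi \<theta> d) / (d * phi \<theta> d)"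
      using \<theta> d phi by (intro tendsto_intros D tendsto_phi) auto
    then show "(\<lambda>n. (X n * \<Delta> (X n) * phi \<theta> (\<Delta> (X n))) / (X n * d * phi \<theta> d)) \<longlonglongrightarrow> 1"
      using X(2) d phi by (simp add: mult.assoc order_less_imp_not_eq2)
  qed
  then show "((\<lambda>T. (T * \<Delta> T * phi \<theta> (\<Delta> T)) / (T * \<Delta>\<^sub>i\<^sub>n\<^sub>f * phi \<theta> \<Delta>\<^sub>i\<^sub>n\<^sub>f)) \<longlongrightarrow> 1) at_top"
    by (simp add: d_def)
qed

end
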